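(* Let $A\subseteq\mathbb{N}$ be a nonrecursive set which is not isomorphic to a cylinder. Then every at most countable partial order $(P,\sqsubset)$ can be embedded (not necessarily effectively) into each of the following structures: (a) the partially ordered set of one-one degrees inside the finite-one degree of $A$; (b) the partially ordered set of one-one degrees inside the many-one degree of $A$. Furthermore, every nonrecursive nonirreducible many-one degree, and likewise every nonrecursive nonirreducible finite-one degree, has a representative $A$ which is neither recursive nor a cylinder; thus every countable partial order can be embedded into the structure of one-one degrees inside such a degree.
   Context: All sets are subsets of $\mathbb{N}=\{0,1,2,\ldots\}$, identified with their characteristic functions. A many-one reduction from $A$ to $B$ is a total recursive function $f:\mathbb{N}\to\mathbb{N}$ with $A(x)=B(f(x))$ for all $x$. It is a finite-one reduction if for each $y$ there are at most finitely many $x$ with $f(x)=y$, and a one-one reduction if for each $y$ there is at most one $x$ with $f(x)=y$. $A$ is many-one (finite-one, one-one) reducible to $B$ if such a reduction exists; equivalence means reducibility in both directions, and the many-one (finite-one, one-one) degree of $A$ is the set of all $B\subseteq\mathbb{N}$ equivalent to $A$ in that sense. The one-one degrees contained in a given many-one or finite-one degree are partially ordered by one-one reducibility of representatives. A degree is nonrecursive if its members are nonrecursive sets. A many-one (finite-one) degree is irreducible if it consists of a single one-one degree, and nonirreducible otherwise. A set $A$ is a cylinder if it is one-one equivalent to $A\times\mathbb{N}$ (coded as a subset of $\mathbb{N}$ by a recursive pairing bijection). Two sets are isomorphic if one is mapped to the other by a recursive permutation of $\mathbb{N}$. An embedding of $(P,\sqsubset)$ is an injective map $\iota$ such that for all distinct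 $p,q\in P$, $p\sqsubset q$ iff $\iota(p)$ is below $\iota(q)$. *)

theory Defs
  imports "HOL-Library.Countable_Set" "HOL-Library.Nat_Bijection"
begin

text \<open>
  Kleene's partial recursive functions, as programs with a big-step evaluation relation.
  Programs carry no arity: restricted to argument lists of a fixed length \<open>n\<close>, a program computes
  an \<open>n\<close>-ary partial recursive function. Primitive recursion and minimization act on the head of
  the argument list; in a primitive recursion step the list is predecessor, previous value,
  parameters.
\<close>

datatype recf =
    Zero
  | Succ
  | Proj nat
  | Comp recf "recf list"
  | PrimRec recf recf
  | Mu recf

inductive evaluates :: "recf \<Rightarrow> nat list \<Rightarrow> nat \<Rightarrow> bool" where
  evaluates_Zero: "evaluates Zero xs 0"
| evaluates_Succ: "evaluates Succ [x] (Suc x)"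
| evaluates_Proj: "i < length xs \<Longrightarrow> evaluates (Proj i) xs (xs ! i)"
| evaluates_Comp: "list_all2 (\<lambda>g y. evaluates g xs y) gs ys \<Longrightarrow> evaluates f ys z \<Longrightarrow> evaluates (Comp f gs) xs z"
| evaluates_PrimRec_0: "evaluates f xs z \<Longrightarrow> evaluates (PrimRec f g) (0 # xs) z"
| evaluates_PrimRec_Suc: "evaluates (PrimRec f g) (n # xs) y \<Longrightarrow> evaluates g (n # y # xs) z
    \<Longrightarrow> evaluates (PrimRec f g) (Suc n # xs) z"
| evaluates_Mu: "evaluates f (n # xs) 0 \<Longrightarrow> (\<forall>m<n. \<exists>k. evaluates f (m # xs) (Suc k)) \<Longrightarrow> evaluates (Mu f) xs n"

inductive_cases evaluates_ZeroE: "evaluates Zero xs y"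
inductive_cases evaluates_SuccE: "evaluates Succ xs y"
inductive_cases evaluates_ProjE: "evaluates (Proj i) xs y"
inductive_cases evaluates_CompE: "evaluates (Comp f gs) xs y"
inductive_cases evaluates_PrimRec_0E: "evaluates (PrimRec f g) (0 # xs) y"
inductive_cases evaluates_PrimRec_SucE: "evaluates (PrimRec f g) (Suc n # xs) y"
inductive_cases evaluates_MuE: "evaluates (Mu f) xs y"

lemma evaluates_deterministic: "evaluates p xs y \<Longrightarrow> evaluates p xs z \<Longrightarrow> y = z"
proof (induction arbitrary: z rule: evaluates.induct)
  case (evaluates_Comp xs gs ys f w)
  from evaluates_Comp.prems obtain ys' where ys': "list_all2 (\<lambda>g y. evaluates g xs y) gs ys'" "evaluates f ys' z"
    by (elim evaluates_CompE) blast
  have "ys = ys'"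
    using evaluates_Comp.IH(1) ys'(1) by (auto simp: list_all2_conv_all_nth intro!: nth_equalityI)
  with evaluates_Comp.IH(2) ys'(2) show ?case by simp
next
  case (evaluates_PrimRec_Suc f g n xs y w)
  from evaluates_PrimRec_Suc.prems obtain y' where "evaluates (PrimRec f g) (n # xs) y'" "evaluates g (n # y' # xs) z"
    by (elim evaluates_PrimRec_SucE) blast
  with evaluates_PrimRec_Suc.IH show ?case by metis
next
  case (evaluates_Mu f n xs)
  from evaluates_Mu.prems have z: "evaluates f (z # xs) 0" "\<forall>m<z. \<exists>k. evaluates f (m # xs) (Suc k)"
    by (auto elim: evaluates_MuE)
  show ?case
  proof (rule linorder_cases[of n z])
    assume "n < z"
    with z(2) evaluates_Mu.IH(1) show ?thesis by (metis nat.distinct(1))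
  next
    assume "z < n"
    with z(1) evaluates_Mu.IH(2) show ?thesis by (metis nat.distinct(1))
  qed
qed (blast elim: evaluates_ZeroE evaluates_SuccE evaluates_ProjE evaluates_PrimRec_0E)+

definition total_recursive :: "(nat \<Rightarrow> nat) \<Rightarrow> bool" where
  "total_recursive f \<longleftrightarrow> (\<exists>p. \<forall>x. evaluates p [x] (f x))"

definition recursive_set :: "nat set \<Rightarrow> bool" where
  "recursive_set A \<longleftrightarrow> total_recursive (\<lambda>x. of_bool (x \<in> A))"

definition many_one_reduction :: "nat set \<Rightarrow> nat set \<Rightarrow> (nat \<Rightarrow> nat) \<Rightarrow> bool" where
  "many_one_reduction A B f \<longleftrightarrow> total_recursive f \<and> (\<forall>x. x \<in> A \<longleftrightarrow> f x \<in> B)"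

definition many_one_reducible :: "nat set \<Rightarrow> nat set \<Rightarrow> bool" where
  "many_one_reducible A B \<longleftrightarrow> (\<exists>f. many_one_reduction A B f)"

definition finite_one_reducible :: "nat set \<Rightarrow> nat set \<Rightarrow> bool" where
  "finite_one_reducible A B \<longleftrightarrow> (\<exists>f. many_one_reduction A B f \<and> (\<forall>y. finite {x. f x = y}))"

definition one_one_reducible :: "nat set \<Rightarrow> nat set \<Rightarrow> bool" where
  "one_one_reducible A B \<longleftrightarrow> (\<exists>f. many_one_reduction A B f \<and> inj f)"

text \<open>Below, \<open>red\<close> stands for any one of the three reducibilities.\<close>

definition equivalent :: "(nat set \<Rightarrow> nat set \<Rightarrow> bool) \<Rightarrow> nat set \<Rightarrow> nat set \<Rightarrow> bool" where
  "equivalent red A B \<longleftrightarrow> red A B \<and> red B A"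

definition degree_of :: "(nat set \<Rightarrow> nat set \<Rightarrow> bool) \<Rightarrow> nat set \<Rightarrow> nat set set" where
  "degree_of red A = {B. equivalent red A B}"

definition is_degree :: "(nat set \<Rightarrow> nat set \<Rightarrow> bool) \<Rightarrow> nat set set \<Rightarrow> bool" where
  "is_degree red D \<longleftrightarrow> (\<exists>A. D = degree_of red A)"

definition one_one_degrees_in :: "nat set set \<Rightarrow> nat set set set" where
  "one_one_degrees_in D = {d. is_degree one_one_reducible d \<and> d \<subseteq> D}"

definition one_one_degree_le :: "nat set set \<Rightarrow> nat set set \<Rightarrow> bool" where
  "one_one_degree_le d e \<longleftrightarrow> (\<exists>A\<in>d. \<exists>B\<in>e. one_one_reducible A B)"

definition nonrecursive_degree :: "nat set set \<Rightarrow> bool" where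
  "nonrecursive_degree D \<longleftrightarrow> (\<forall>A\<in>D. \<not> recursive_set A)"

definition irreducible_degree :: "nat set set \<Rightarrow> bool" where
  "irreducible_degree D \<longleftrightarrow> is_degree one_one_reducible D"

definition cylinder :: "nat set \<Rightarrow> bool" where
  "cylinder A \<longleftrightarrow> equivalent one_one_reducible A (prod_encode ` (A \<times> UNIV))"

definition isomorphic :: "nat set \<Rightarrow> nat set \<Rightarrow> bool" where
  "isomorphic A B \<longleftrightarrow> (\<exists>\<pi>. total_recursive \<pi> \<and> bij \<pi> \<and> \<pi> ` A = B)"

text \<open>
  The order of \<open>P\<close> is compared with \<open>le\<close> at distinct points only, so it makes no difference
  whether the two relations are taken to be reflexive or strict.
\<close>

definition embeds_in :: "'a set \<Rightarrow> 'a rel \<Rightarrow> 'b set \<Rightarrow> ('b \<Rightarrow> 'b \<Rightarrow> bool) \<Rightarrow> bool" where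
  "embeds_in P r S le \<longleftrightarrow> (\<exists>\<iota>. inj_on \<iota> P \<and> \<iota> ` P \<subseteq> S \<and>
     (\<forall>p\<in>P. \<forall>q\<in>P. p \<noteq> q \<longrightarrow> ((p, q) \<in> r \<longleftrightarrow> le (\<iota> p) (\<iota> q))))"

end

theory Submission
  imports Defs
begin

text \<open>
  Let \<open>A\<close> be nonrecursive and not a cylinder. Replacing every element of \<open>A\<close> by finitely many
  copies of itself leads to a set in the finite-one degree of \<open>A\<close>. Here the copies are tokens: a
  recursive function \<open>token\<close> gives every \<open>n\<close> a label and a place, every place carries a base
  token, and no place carries infinitely many tokens (\<open>finite_place\<close>). For a recursive
  set \<open>S\<close> of labels, \<open>pullback A S\<close> is the set of the tokens labelled in \<open>S\<close> whose place is in
  \<open>A\<close>. It is finite-one equivalent to \<open>A\<close>, and it grows with \<open>S\<close> in the sense of one-one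
  reducibility. One sequence of tokens serves all sets \<open>A\<close> and all partial orders: a countable
  order is represented by inclusion of recursive sets (\<open>countable_order_as_recursive_sets\<close>), and it
  remains to see that \<open>pullback A S\<close> is one-one reducible to \<open>pullback A T\<close> only if
  \<open>S \<subseteq> T\<close> (\<open>pullback_reflects_subset\<close>).

  Suppose that \<open>r \<in> S - T\<close> and that the injection \<open>g\<close> on tokens gives such a reduction. Call a
  finite set \<open>D\<close> of places closed if \<open>g\<close> sends every \<open>S\<close>-token on \<open>D\<close> to a \<open>T\<close>-token on \<open>D\<close>; then
  \<open>D\<close> carries at most as many \<open>S\<close>-tokens as \<open>T\<close>-tokens. Whenever such a set is seen, a
  token labelled \<open>r\<close> is added on it, until counting forces \<open>g\<close> to send a token on \<open>D\<close> out of \<open>D\<close>.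
  In the end no \<open>D\<close> is closed if it has an element beyond some bound (\<open>requirement_met\<close>). As \<open>g\<close>
  preserves membership of places in \<open>A\<close>, every such \<open>D\<close> that lies inside \<open>A\<close>, or inside the
  complement of \<open>A\<close>, now effectively yields a new element on the same side of \<open>A\<close>. A
  nonrecursive set that admits this is a cylinder (\<open>cylinder_if_fresh\<close>), a contradiction.

  The difficulty lies in doing this for all partial recursive \<open>g\<close> and all \<open>r\<close> at once, since the
  tokens added for one requirement may count as \<open>T\<close>-tokens for another one. All tokens for \<open>D\<close> are
  put on the largest element \<open>y\<close> of \<open>D\<close>. Then work at \<open>y\<close> leaves the sets below \<open>y\<close> undisturbed, and
  only the finitely many requirements with index at most \<open>y\<close>, ordered by index, compete for \<open>y\<close>.
  Once \<open>g\<close> has been seen to leave \<open>D\<close> it has done so for good, so lower requirements may go on. A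
  requirement whose \<open>g\<close> is not total can block the others forever at one place only, namely the
  least one that carries a token on which \<open>g\<close> diverges.

  A degree all of whose members are cylinders is a single one-one degree, because many-one
  reducibility to a cylinder is one-one reducibility. So nonirreducible degrees contain a
  set that is not a cylinder.
\<close>

section \<open>Closure properties of the total recursive functions\<close>

text \<open>
  Functions of several arguments serve to obtain a recursive pairing function, and to pass from
  primitive recursion and minimization of programs to the corresponding operators on packed arguments.
\<close>

definition recursive_n :: "nat \<Rightarrow> (nat list \<Rightarrow> nat) \<Rightarrow> bool" where
  "recursive_n n F \<longleftrightarrow> (\<exists>p. \<forall>xs. length xs = n \<longrightarrow> evaluates p xs (F xs))"

lemma total_recursive_iff: "total_recursive f \<longleftrightarrow> recursive_n 1 (\<lambda>xs. f (hd xs))"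
proof -
  have "(\<forall>xs. length xs = 1 \<longrightarrow> evaluates p xs (f (hd xs))) \<longleftrightarrow> (\<forall>x. evaluates p [x] (f x))" for p
    by (auto simp: length_Suc_conv)
  then show ?thesis unfolding total_recursive_def recursive_n_def by simp
qed

lemma recursive_n_proj: "i < n \<Longrightarrow> recursive_n n (\<lambda>xs. xs ! i)"
  unfolding recursive_n_def by (rule exI[of _ "Proj i"]) (auto intro: evaluates_Proj)

lemma recursive_n_zero: "recursive_n n (\<lambda>xs. 0)"
  unfolding recursive_n_def by (rule exI[of _ Zero]) (auto intro: evaluates_Zero)

lemma recursive_n_comp1:
  assumes "recursive_n 1 F" "recursive_n n G"
  shows "recursive_n n (\<lambda>xs. F [G xs])"
proof -
  obtain p q where p: "\<And>xs. length xs = 1 \<Longrightarrow> evaluates p xs (F xs)"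
    and q: "\<And>xs. length xs = n \<Longrightarrow> evaluates q xs (G xs)"
    using assms unfolding recursive_n_def by blast
  have "evaluates (Comp p [q]) xs (F [G xs])" if "length xs = n" for xs
    by (rule evaluates_Comp[of _ _ "[G xs]"]) (use p q that in auto)
  then show ?thesis unfolding recursive_n_def by blast
qed

lemma recursive_n_comp2:
  assumes "recursive_n 2 F" "recursive_n n G" "recursive_n n H"
  shows "recursive_n n (\<lambda>xs. F [G xs, H xs])"
proof -
  obtain p q r where p: "\<And>xs. length xs = 2 \<Longrightarrow> evaluates p xs (F xs)"
    and q: "\<And>xs. length xs = n \<Longrightarrow> evaluates q xs (G xs)"
    and r: "\<And>xs. length xs = n \<Longrightarrow> evaluates r xs (H xs)"
    using assms unfolding recursive_n_def by blast
  have "evaluates (Comp p [q, r]) xs (F [G xs, H xs])" if "length xs = n" for xs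
    by (rule evaluates_Comp[of _ _ "[G xs, H xs]"]) (use p q r that in auto)
  then show ?thesis unfolding recursive_n_def by blast
qed

lemma recursive_n_suc:
  assumes "recursive_n n F"
  shows "recursive_n n (\<lambda>xs. Suc (F xs))"
proof -
  have "recursive_n 1 (\<lambda>xs. Suc (hd xs))"
    unfolding recursive_n_def
    by (rule exI[of _ Succ]) (auto simp: length_Suc_conv intro: evaluates_Succ)
  from recursive_n_comp1[OF this assms] show ?thesis by simp
qed

lemma recursive_n_primrec:
  assumes "recursive_n n F" "recursive_n (Suc (Suc n)) G"
  shows "recursive_n (Suc n) (\<lambda>xs. rec_nat (F (tl xs)) (\<lambda>k y. G (k # y # tl xs)) (hd xs))"
proof -
  obtain p q where p: "\<And>xs. length xs = n \<Longrightarrow> evaluates p xs (F xs)"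
    and q: "\<And>xs. length xs = Suc (Suc n) \<Longrightarrow> evaluates q xs (G xs)"
    using assms unfolding recursive_n_def by blast
  have "evaluates (PrimRec p q) (k # xs) (rec_nat (F xs) (\<lambda>k y. G (k # y # xs)) k)"
    if "length xs = n" for k xs
  proof (induction k)
    case 0
    show ?case using p[OF that] by (auto intro: evaluates_PrimRec_0)
  next
    case (Suc k)
    show ?case using evaluates_PrimRec_Suc[OF Suc.IH q] that by simp
  qed
  then have "\<forall>xs. length xs = Suc n \<longrightarrow>
      evaluates (PrimRec p q) xs (rec_nat (F (tl xs)) (\<lambda>k y. G (k # y # tl xs)) (hd xs))"
    by (auto simp: length_Suc_conv)
  then show ?thesis unfolding recursive_n_def by blast
qed

lemma recursive_n_least:
  assumes "recursive_n (Suc n) F" "\<And>xs. length xs = n \<Longrightarrow> \<exists>k. F (k # xs) = 0"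
  shows "recursive_n n (\<lambda>xs. LEAST k. F (k # xs) = 0)"
proof -
  obtain p where p: "\<And>xs. length xs = Suc n \<Longrightarrow> evaluates p xs (F xs)"
    using assms unfolding recursive_n_def by blast
  have "evaluates (Mu p) xs (LEAST k. F (k # xs) = 0)" if len: "length xs = n" for xs
  proof (rule evaluates_Mu)
    show "evaluates p ((LEAST k. F (k # xs) = 0) # xs) 0"
      using p[of "(LEAST k. F (k # xs) = 0) # xs"] LeastI_ex[OF assms(2)[OF len]] len by simp
    show "\<forall>m<LEAST k. F (k # xs) = 0. \<exists>k. evaluates p (m # xs) (Suc k)"
    proof (intro allI impI)
      fix m assume "m < (LEAST k. F (k # xs) = 0)"
      then have "F (m # xs) \<noteq> 0" by (rule not_less_Least)
      then obtain k where "F (m # xs) = Suc k" using not0_implies_Suc by blast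
      then show "\<exists>k. evaluates p (m # xs) (Suc k)" using p[of "m # xs"] len by auto
    qed
  qed
  then show ?thesis unfolding recursive_n_def by blast
qed

lemma recursive_n_add: "recursive_n 2 (\<lambda>xs. xs ! 0 + xs ! 1)"
proof -
  have "recursive_n (Suc 1) (\<lambda>xs. rec_nat (tl xs ! 0) (\<lambda>k y. Suc ((k # y # tl xs) ! 1)) (hd xs))"
    by (intro recursive_n_primrec recursive_n_proj recursive_n_suc) auto
  moreover have "rec_nat b (\<lambda>k. Suc) a = a + b" for a b :: nat by (induction a) auto
  ultimately show ?thesis
    unfolding recursive_n_def by (simp add: numeral_2_eq_2 length_Suc_conv) (metis nth_Cons_0 nth_Cons_Suc list.sel)
qed

lemma recursive_n_diff: "recursive_n 2 (\<lambda>xs. xs ! 0 - xs ! 1)"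
proof -
  have pred_eq: "rec_nat 0 (\<lambda>k y. k) a = a - 1" for a :: nat by (cases a) auto
  have "recursive_n (Suc 0) (\<lambda>xs. rec_nat 0 (\<lambda>k y. (k # y # tl xs) ! 0) (hd xs))"
    by (intro recursive_n_primrec recursive_n_proj recursive_n_zero) auto
  then have pred: "recursive_n 1 (\<lambda>xs. hd xs - 1)" by (simp add: pred_eq)
  have "recursive_n (Suc (Suc 0)) (\<lambda>xs. rec_nat (tl xs ! 0) (\<lambda>k y. hd [(k # y # tl xs) ! 1] - 1) (hd xs))"
    by (intro recursive_n_primrec recursive_n_proj recursive_n_comp1[OF pred]) auto
  moreover have "rec_nat b (\<lambda>k y. y - Suc 0) a = b - a" for a b :: nat by (induction a) auto
  ultimately have "recursive_n 2 (\<lambda>xs. tl xs ! 0 - hd xs)" by (simp add: numeral_2_eq_2)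
  then have "recursive_n 2 (\<lambda>xs. tl [xs ! 1, xs ! 0] ! 0 - hd [xs ! 1, xs ! 0])"
    by (rule recursive_n_comp2) (auto intro: recursive_n_proj)
  then show ?thesis by simp
qed

lemma recursive_n_triangle: "recursive_n 1 (\<lambda>xs. triangle (hd xs))"
proof -
  have "recursive_n (Suc 0)
      (\<lambda>xs. rec_nat 0 (\<lambda>k y. [Suc ((k # y # tl xs) ! 0), (k # y # tl xs) ! 1] ! 0
                            + [Suc ((k # y # tl xs) ! 0), (k # y # tl xs) ! 1] ! 1) (hd xs))"
    by (intro recursive_n_primrec recursive_n_comp2[OF recursive_n_add] recursive_n_suc
        recursive_n_proj recursive_n_zero) auto
  moreover have "rec_nat 0 (\<lambda>k y. Suc k + y) a = triangle a" for a by (induction a) auto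
  ultimately show ?thesis by simp
qed

lemma recursive_n_pair: "recursive_n 2 (\<lambda>xs. prod_encode (xs ! 0, xs ! 1))"
proof -
  have s: "recursive_n 2 (\<lambda>xs. triangle (hd [xs ! 0 + xs ! 1]))"
    by (rule recursive_n_comp1[OF recursive_n_triangle recursive_n_add])
  have "recursive_n 2 (\<lambda>xs. [triangle (hd [xs ! 0 + xs ! 1]), xs ! 0] ! 0
        + [triangle (hd [xs ! 0 + xs ! 1]), xs ! 0] ! 1)"
    by (rule recursive_n_comp2[OF recursive_n_add s]) (auto intro: recursive_n_proj)
  then show ?thesis by (simp add: prod_encode_def)
qed

text \<open>
  The pair coded by \<open>z\<close> lies on the diagonal \<open>x + y = w\<close>, which is the last one whose first code
  \<open>triangle w\<close> does not exceed \<open>z\<close>.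
\<close>

lemma pair_decode_via_diagonal:
  fixes z :: nat
  defines "w \<equiv> LEAST w. Suc z - triangle (Suc w) = 0"
  shows "fst (prod_decode z) = z - triangle w" "snd (prod_decode z) = w - (z - triangle w)"
proof -
  obtain a b where z: "z = prod_encode (a, b)" by (metis prod_decode_inverse surj_pair)
  have mono: "triangle i \<le> triangle j" if "i \<le> j" for i j
    using that by (induction rule: dec_induct) auto
  have "w = a + b"
    unfolding w_def
  proof (rule Least_equality)
    fix v assume v: "Suc z - triangle (Suc v) = 0"
    show "a + b \<le> v"
    proof (rule ccontr)
      assume "\<not> a + b \<le> v"
      then have "triangle (Suc v) \<le> triangle (a + b)" by (intro mono) simp
      with v z show False by (simp add: prod_encode_def)
    qed
  qed (simp add: z prod_encode_def)
  then show "fst (prod_decode z) = z - triangle w" "snd (prod_decode z) = w - (z - triangle w)"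
    by (simp_all add: z) (simp_all add: prod_encode_def)
qed

lemma recursive_n_decode:
  "recursive_n 1 (\<lambda>xs. fst (prod_decode (hd xs)))" "recursive_n 1 (\<lambda>xs. snd (prod_decode (hd xs)))"
proof -
  have tri: "recursive_n n (\<lambda>xs. triangle (F xs))" if "recursive_n n F" for n F
    using recursive_n_comp1[OF recursive_n_triangle that] by simp
  have diff: "recursive_n n (\<lambda>xs. F xs - G xs)" if "recursive_n n F" "recursive_n n G" for n F G
    using recursive_n_comp2[OF recursive_n_diff that] by simp
  have ex: "\<exists>k. Suc z - triangle (Suc k) = 0" for z
    by (rule exI[of _ z]) simp
  have "recursive_n 1 (\<lambda>xs. LEAST k. Suc ((k # xs) ! 1) - triangle (Suc ((k # xs) ! 0)) = 0)"
  proof (rule recursive_n_least)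
    show "recursive_n (Suc 1) (\<lambda>xs. Suc (xs ! 1) - triangle (Suc (xs ! 0)))"
      by (intro diff tri recursive_n_suc recursive_n_proj) auto
  qed (use ex in simp)
  then have w: "recursive_n 1 (\<lambda>xs. LEAST k. Suc (xs ! 0) - triangle (Suc k) = 0)" by simp
  have z: "recursive_n 1 (\<lambda>xs. xs ! 0)" by (rule recursive_n_proj) simp
  have hd: "length xs = 1 \<Longrightarrow> hd xs = xs ! 0" for xs :: "nat list" by (cases xs) auto
  have "recursive_n 1 (\<lambda>xs. fst (prod_decode (xs ! 0)))" "recursive_n 1 (\<lambda>xs. snd (prod_decode (xs ! 0)))"
    unfolding pair_decode_via_diagonal by (intro diff tri w z)+
  then show "recursive_n 1 (\<lambda>xs. fst (prod_decode (hd xs)))" "recursive_n 1 (\<lambda>xs. snd (prod_decode (hd xs)))"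
    unfolding recursive_n_def by (simp_all add: hd)
qed

abbreviation pfst :: "nat \<Rightarrow> nat" where "pfst z \<equiv> fst (prod_decode z)"
abbreviation psnd :: "nat \<Rightarrow> nat" where "psnd z \<equiv> snd (prod_decode z)"

text \<open>
  From here on all arguments are packed into one number, so that recursiveness of a compound
  expression can be read off its syntax: the rules in \<open>recursive_intros\<close> match the outermost operator.
  A rule for a binding operator turns the bound variable into a projection of the packed argument.
\<close>

abbreviation decidable :: "(nat \<Rightarrow> bool) \<Rightarrow> bool" where
  "decidable P \<equiv> total_recursive (\<lambda>x. of_bool (P x))"

named_theorems recursive_intros

lemma recursive_id [recursive_intros]: "total_recursive (\<lambda>x. x)"
  unfolding total_recursive_def by (rule exI[of _ "Proj 0"]) (auto intro: evaluates_Proj[of 0 "[x]" for x, simplified])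

lemma recursive_comp:
  assumes "total_recursive f" "total_recursive g"
  shows "total_recursive (\<lambda>x. f (g x))"
  using recursive_n_comp1[OF assms[unfolded total_recursive_iff]] by (simp add: total_recursive_iff)

lemma recursive_binary:
  assumes "recursive_n 2 (\<lambda>xs. F (xs ! 0) (xs ! 1))" "total_recursive f" "total_recursive g"
  shows "total_recursive (\<lambda>x. F (f x) (g x))"
  using recursive_n_comp2[OF assms(1) assms(2,3)[unfolded total_recursive_iff]]
  by (simp add: total_recursive_iff)

lemma recursive_Suc [recursive_intros]: "total_recursive f \<Longrightarrow> total_recursive (\<lambda>x. Suc (f x))"
  unfolding total_recursive_iff by (rule recursive_n_suc)

lemma recursive_const [recursive_intros]: "total_recursive (\<lambda>x. c)"
proof (induction c)
  case 0 show ?case unfolding total_recursive_iff by (rule recursive_n_zero)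
qed (rule recursive_Suc)

lemmas recursive_add [recursive_intros] = recursive_binary[OF recursive_n_add]
lemmas recursive_diff [recursive_intros] = recursive_binary[OF recursive_n_diff]
lemmas recursive_pair [recursive_intros] = recursive_binary[where F = "\<lambda>x y. prod_encode (x, y)", OF recursive_n_pair]

lemma recursive_pfst [recursive_intros]: "total_recursive f \<Longrightarrow> total_recursive (\<lambda>x. pfst (f x))"
  by (rule recursive_comp[of pfst]) (simp_all only: total_recursive_iff recursive_n_decode)

lemma recursive_psnd [recursive_intros]: "total_recursive f \<Longrightarrow> total_recursive (\<lambda>x. psnd (f x))"
  by (rule recursive_comp[of psnd]) (simp_all only: total_recursive_iff recursive_n_decode)

lemma recursive_rec_nat [recursive_intros]:
  assumes n: "total_recursive n" and a: "total_recursive a"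
    and F: "total_recursive (\<lambda>z. F (pfst (pfst z)) (psnd (pfst z)) (psnd z))"
  shows "total_recursive (\<lambda>x. rec_nat (a x) (\<lambda>k y. F x k y) (n x))"
proof -
  have pair: "recursive_n n (\<lambda>xs. prod_encode (G xs, H xs))" if "recursive_n n G" "recursive_n n H" for n G H
    using recursive_n_comp2[OF recursive_n_pair that] by simp
  have F': "recursive_n 3 (\<lambda>xs. F (xs ! 2) (xs ! 0) (xs ! 1))"
    using recursive_n_comp1[OF F[unfolded total_recursive_iff],
        of 3 "\<lambda>xs. prod_encode (prod_encode (xs ! 2, xs ! 0), xs ! 1)"]
    by (simp add: pair recursive_n_proj)
  have a': "recursive_n 1 (\<lambda>xs. a (xs ! 0))"
    using recursive_n_comp1[OF a[unfolded total_recursive_iff], of 1 "\<lambda>xs. xs ! 0"]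
    by (simp add: recursive_n_proj)
  have "recursive_n (Suc 1) (\<lambda>xs. rec_nat (a (tl xs ! 0))
      (\<lambda>k y. F ((k # y # tl xs) ! 2) ((k # y # tl xs) ! 0) ((k # y # tl xs) ! 1)) (hd xs))"
    by (rule recursive_n_primrec[OF a']) (use F' in \<open>simp add: numeral_3_eq_3\<close>)
  from recursive_n_comp2[OF this[unfolded One_nat_def, folded numeral_2_eq_2], of 1 "\<lambda>xs. n (hd xs)" "\<lambda>xs. hd xs"]
  show ?thesis
    using n recursive_id by (simp add: total_recursive_iff)
qed

lemma recursive_funpow [recursive_intros]:
  assumes "total_recursive n" "total_recursive a" "total_recursive (\<lambda>z. F (pfst z) (psnd z))"
  shows "total_recursive (\<lambda>x. (F x ^^ n x) (a x))"
proof -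
  have "(F x ^^ m) (a x) = rec_nat (a x) (\<lambda>k y. F x y) m" for x m
    by (induction m) auto
  moreover have "total_recursive (\<lambda>x. rec_nat (a x) (\<lambda>k y. F x y) (n x))"
    using recursive_comp[OF assms(3), of "\<lambda>z. prod_encode (pfst (pfst z), psnd z)"]
    by (intro recursive_rec_nat assms) (simp add: recursive_intros)
  ultimately show ?thesis by simp
qed

lemma decidable_not [recursive_intros]:
  assumes "decidable P" shows "decidable (\<lambda>x. \<not> P x)"
proof -
  have "total_recursive (\<lambda>x. 1 - of_bool (P x))" by (intro recursive_intros assms)
  moreover have "1 - of_bool b = (of_bool (\<not> b) :: nat)" for b by (cases b) auto
  ultimately show ?thesis by (simp only:)
qed

lemma decidable_conj [recursive_intros]:
  assumes "decidable P" "decidable Q" shows "decidable (\<lambda>x. P x \<and> Q x)"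
proof -
  have "total_recursive (\<lambda>x. of_bool (P x) + of_bool (Q x) - 1)" by (intro recursive_intros assms)
  moreover have "of_bool b + of_bool c - 1 = (of_bool (b \<and> c) :: nat)" for b c by (cases b; cases c) auto
  ultimately show ?thesis by (simp only:)
qed

lemma decidable_disj [recursive_intros]:
  assumes "decidable P" "decidable Q" shows "decidable (\<lambda>x. P x \<or> Q x)"
proof -
  have "decidable (\<lambda>x. \<not> (\<not> P x \<and> \<not> Q x))" by (intro recursive_intros assms)
  then show ?thesis by (simp only: de_Morgan_conj not_not)
qed

lemma decidable_imp [recursive_intros]:
  assumes "decidable P" "decidable Q" shows "decidable (\<lambda>x. P x \<longrightarrow> Q x)"
proof -
  have "decidable (\<lambda>x. \<not> P x \<or> Q x)" by (intro recursive_intros assms)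
  then show ?thesis by (simp only: imp_conv_disj)
qed

lemma decidable_le [recursive_intros]:
  assumes "total_recursive f" "total_recursive g" shows "decidable (\<lambda>x. f x \<le> g x)"
proof -
  have "total_recursive (\<lambda>x. 1 - (f x - g x))" by (intro recursive_intros assms)
  moreover have "1 - (a - b) = of_bool (a \<le> b)" for a b :: nat by (cases "a \<le> b") auto
  ultimately show ?thesis by (simp only:)
qed

lemma decidable_less [recursive_intros]:
  assumes "total_recursive f" "total_recursive g" shows "decidable (\<lambda>x. f x < g x)"
  unfolding Suc_le_eq[symmetric] by (intro recursive_intros assms)

lemma decidable_eq [recursive_intros]:
  assumes "total_recursive f" "total_recursive g" shows "decidable (\<lambda>x. f x = g x)"
  unfolding order_eq_iff by (intro recursive_intros assms)

lemma recursive_if [recursive_intros]: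
  assumes "decidable P" "total_recursive f" "total_recursive g"
  shows "total_recursive (\<lambda>x. if P x then f x else g x)"
proof -
  have "total_recursive (\<lambda>x. rec_nat (g x) (\<lambda>k y. f x) (of_bool (P x)))"
    using recursive_comp[OF assms(2), of "\<lambda>z. pfst (pfst z)"]
    by (intro recursive_intros assms) (simp add: recursive_intros)
  moreover have "rec_nat b (\<lambda>k y. a) (of_bool c) = (if c then a else b)" for a b :: nat and c by simp
  ultimately show ?thesis by simp
qed

text \<open>Bounded quantifiers are obtained from this rule, by adding the bound as a witness.\<close>

lemma recursive_least [recursive_intros]:
  assumes "decidable (\<lambda>z. P (pfst z) (psnd z))" "\<And>x. \<exists>n. P x n"
  shows "total_recursive (\<lambda>x. LEAST n. P x n)"
proof -
  have "decidable (\<lambda>z. \<not> P (pfst z) (psnd z))" by (intro recursive_intros assms)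
  then have "recursive_n 1 (\<lambda>xs. of_bool (\<not> P (pfst (hd xs)) (psnd (hd xs))))"
    by (simp only: total_recursive_iff)
  moreover have "recursive_n 2 (\<lambda>xs. prod_encode ([xs ! 1, xs ! 0] ! 0, [xs ! 1, xs ! 0] ! 1))"
    by (rule recursive_n_comp2[OF recursive_n_pair]) (auto intro: recursive_n_proj)
  ultimately have "recursive_n 2
      (\<lambda>xs. of_bool (\<not> P (pfst (hd [prod_encode ([xs ! 1, xs ! 0] ! 0, [xs ! 1, xs ! 0] ! 1)]))
                    (psnd (hd [prod_encode ([xs ! 1, xs ! 0] ! 0, [xs ! 1, xs ! 0] ! 1)]))))"
    by (rule recursive_n_comp1)
  then have "recursive_n (Suc 1) (\<lambda>xs. of_bool (\<not> P (xs ! 1) (xs ! 0)))"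
    by (simp add: numeral_2_eq_2)
  then have "recursive_n 1 (\<lambda>xs. LEAST k. of_bool (\<not> P ((k # xs) ! 1) ((k # xs) ! 0)) = (0::nat))"
    by (rule recursive_n_least) (use assms(2) in auto)
  then have "recursive_n 1 (\<lambda>xs. LEAST k. P (xs ! 0) k)" by simp
  then show ?thesis
    using recursive_n_comp1[of "\<lambda>xs. LEAST k. P (xs ! 0) k" 1 "\<lambda>xs. hd xs"] recursive_id
    by (simp add: total_recursive_iff)
qed

lemma decidable_bounded_ex [recursive_intros]:
  assumes b: "total_recursive b" and P: "decidable (\<lambda>z. P (pfst z) (psnd z))"
  shows "decidable (\<lambda>x. \<exists>n<b x. P x n)"
proof -
  have "total_recursive (\<lambda>x. LEAST n. b x \<le> n \<or> P x n)"
    using recursive_comp[OF b, of pfst] by (intro recursive_intros P) (auto simp: recursive_intros)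
  then have "decidable (\<lambda>x. (LEAST n. b x \<le> n \<or> P x n) < b x)" by (rule decidable_less[OF _ b])
  moreover have "(LEAST n. b x \<le> n \<or> P x n) < b x \<longleftrightarrow> (\<exists>n<b x. P x n)" for x
  proof
    assume less: "(LEAST n. b x \<le> n \<or> P x n) < b x"
    have "b x \<le> (LEAST n. b x \<le> n \<or> P x n) \<or> P x (LEAST n. b x \<le> n \<or> P x n)"
      by (rule LeastI[of _ "b x"]) simp
    with less show "\<exists>n<b x. P x n" by auto
  next
    assume "\<exists>n<b x. P x n"
    then obtain n where n: "n < b x" "P x n" by blast
    have "(LEAST n. b x \<le> n \<or> P x n) \<le> n" by (rule Least_le) (simp add: n)
    with n show "(LEAST n. b x \<le> n \<or> P x n) < b x" by simp
  qed
  ultimately show ?thesis by simp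
qed

lemma decidable_bounded_all [recursive_intros]:
  assumes b: "total_recursive b" and P: "decidable (\<lambda>z. P (pfst z) (psnd z))"
  shows "decidable (\<lambda>x. \<forall>n<b x. P x n)"
proof -
  have "decidable (\<lambda>x. \<not> (\<exists>n<b x. \<not> P x n))" by (intro recursive_intros assms)
  then show ?thesis by simp
qed

lemma recursive_mult [recursive_intros]:
  assumes "total_recursive f" "total_recursive g"
  shows "total_recursive (\<lambda>x. f x * g x)"
proof -
  have "total_recursive (\<lambda>x. rec_nat 0 (\<lambda>k y. y + g x) (f x))"
    using recursive_comp[OF assms(2), of "\<lambda>z. pfst (pfst z)"]
    by (intro recursive_intros assms) (simp add: recursive_intros)
  moreover have "rec_nat 0 (\<lambda>k y. y + b) a = a * b" for a b :: nat by (induction a) auto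
  ultimately show ?thesis by simp
qed

lemma recursive_power2 [recursive_intros]:
  assumes "total_recursive f"
  shows "total_recursive (\<lambda>x. 2 ^ f x)"
proof -
  have "total_recursive (\<lambda>x. rec_nat 1 (\<lambda>k y. y + y) (f x))" by (intro recursive_intros assms)
  moreover have "rec_nat 1 (\<lambda>k y. y + y) a = (2 ^ a :: nat)" for a :: nat by (induction a) auto
  ultimately show ?thesis by simp
qed

text \<open>Finite sets are handled through their binary codes, where \<open>a\<close> is a member iff bit \<open>a\<close> is set.\<close>

lemma decidable_set_decode [recursive_intros]:
  assumes f: "total_recursive f" and g: "total_recursive g"
  shows "decidable (\<lambda>x. f x \<in> set_decode (g x))"
proof -
  have eq: "odd (d div 2 ^ a) \<longleftrightarrow> (\<exists>q<Suc d. \<exists>r<2 ^ a. d = (q + q + 1) * 2 ^ a + r)" for d a :: nat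
  proof
    assume "odd (d div 2 ^ a)"
    then obtain q where q: "d div 2 ^ a = 2 * q + 1" by (elim oddE)
    then have "d = (q + q + 1) * 2 ^ a + d mod 2 ^ a" by (metis div_mult_mod_eq mult_2)
    moreover have "q < Suc d" using q div_le_dividend[of d "2 ^ a"] by linarith
    moreover have "d mod 2 ^ a < 2 ^ a" by simp
    ultimately show "\<exists>q<Suc d. \<exists>r<2 ^ a. d = (q + q + 1) * 2 ^ a + r" by blast
  next
    assume "\<exists>q<Suc d. \<exists>r<2 ^ a. d = (q + q + 1) * 2 ^ a + r"
    then obtain q r where qr: "r < 2 ^ a" "d = (q + q + 1) * 2 ^ a + r" by blast
    then have "d div 2 ^ a = q + q + 1" by (intro div_nat_eqI) (auto simp: algebra_simps)
    then show "odd (d div 2 ^ a)" by simp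
  qed
  have f': "total_recursive (\<lambda>x. f (h x))" if "total_recursive h" for h
    by (rule recursive_comp[OF f that])
  have g': "total_recursive (\<lambda>x. g (h x))" if "total_recursive h" for h
    by (rule recursive_comp[OF g that])
  show ?thesis unfolding set_decode_def mem_Collect_eq eq
    by (intro recursive_intros f' g')
qed

text \<open>These operate on the codes given by \<open>list_encode\<close>; the code \<open>0\<close> of the empty list is its own tail.\<close>

abbreviation list_cons :: "nat \<Rightarrow> nat \<Rightarrow> nat" where "list_cons x l \<equiv> Suc (prod_encode (x, l))"
abbreviation list_hd :: "nat \<Rightarrow> nat" where "list_hd l \<equiv> pfst (l - 1)"
abbreviation list_tl :: "nat \<Rightarrow> nat" where "list_tl l \<equiv> psnd (l - 1)"

lemma list_nth: "n < length xs \<Longrightarrow> list_hd ((list_tl ^^ n) (list_encode xs)) = xs ! n"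
proof (induction n arbitrary: xs)
  case 0
  then show ?case by (cases xs) auto
next
  case (Suc n)
  then obtain x ys where "xs = x # ys" by (cases xs) auto
  with Suc show ?case by (simp add: funpow_Suc_right del: funpow.simps)
qed

text \<open>
  The history is stored as the code of a list with the latest value first, so that it is extended by
  a single cons. The functional \<open>F\<close> is assumed to be recursive only when it looks its argument up in
  such a list.
\<close>

lemma recursive_course_of_values:
  assumes t: "\<And>s. t s = F (\<lambda>n. if n < s then t n else 0) s"
    and F: "total_recursive (\<lambda>z. F (\<lambda>n. if n < psnd z then list_hd ((list_tl ^^ (psnd z - Suc n)) (pfst z)) else 0) (psnd z))"
  shows "total_recursive t"
proof -
  define look where "look h s n = (if n < s then list_hd ((list_tl ^^ (s - Suc n)) h) else 0)" for h s n
  define hist where "hist s = rec_nat 0 (\<lambda>s h. list_cons (F (look h s) s) h) s" for s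
  have Fpair: "total_recursive (\<lambda>z. F (look (a z) (b z)) (b z))"
    if "total_recursive a" "total_recursive b" for a b
    using recursive_comp[OF F recursive_pair[OF that], unfolded prod_encode_inverse fst_conv snd_conv]
    unfolding look_def .
  have "hist s = list_encode (map t (rev [0..<s]))" for s
  proof (induction s)
    case (Suc s)
    have "look (hist s) s = (\<lambda>n. if n < s then t n else 0)"
    proof
      fix n show "look (hist s) s n = (if n < s then t n else 0)"
        using list_nth[of "s - Suc n" "map t (rev [0..<s])"]
        by (auto simp: look_def Suc.IH rev_nth)
    qed
    then show ?case using Suc.IH t[of s] by (simp add: hist_def)
  qed (simp add: hist_def)
  then have "t = (\<lambda>s. list_hd (hist (Suc s)))" by (intro ext) simp
  moreover have "total_recursive hist"
    unfolding hist_def[abs_def] by (intro recursive_intros Fpair)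
  then have "total_recursive (\<lambda>s. list_hd (hist (Suc s)))"
    by (intro recursive_intros) (rule recursive_comp, assumption, intro recursive_intros)
  ultimately show ?thesis by simp
qed

section \<open>A universal evaluator with a step count\<close>

primrec recf_code :: "recf \<Rightarrow> nat" where
  "recf_code Zero = prod_encode (0, 0)"
| "recf_code Succ = prod_encode (1, 0)"
| "recf_code (Proj i) = prod_encode (2, i)"
| "recf_code (Comp f gs) = prod_encode (3, prod_encode (recf_code f, list_encode (map recf_code gs)))"
| "recf_code (PrimRec f g) = prod_encode (4, prod_encode (recf_code f, recf_code g))"
| "recf_code (Mu f) = prod_encode (5, recf_code f)"

text \<open>
  The token construction must watch all partial recursive functions converge. For this purpose
  programs are run by a stack machine whose single step is a case distinction on numbers, hence visibly
  recursive, whereas a recursion over programs would not be. A state pairs a list of pending instructions with a list of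
  values; all of these are codes. Its instructions evaluate a program, evaluate a list of
  programs from the last to the first, call a program on the value list while restoring an older
  value list, continue a primitive recursion, and test a candidate of a minimization.
\<close>

abbreviation instr_eval :: "nat \<Rightarrow> nat \<Rightarrow> nat" where
  "instr_eval p xs \<equiv> prod_encode (0, prod_encode (p, xs))"
abbreviation instr_eval_list :: "nat \<Rightarrow> nat \<Rightarrow> nat" where
  "instr_eval_list ps xs \<equiv> prod_encode (1, prod_encode (ps, xs))"
abbreviation instr_call :: "nat \<Rightarrow> nat \<Rightarrow> nat" where
  "instr_call p vs \<equiv> prod_encode (2, prod_encode (p, vs))"
abbreviation instr_primrec :: "nat \<Rightarrow> nat \<Rightarrow> nat \<Rightarrow> nat" where
  "instr_primrec p n xs \<equiv> prod_encode (3, prod_encode (p, prod_encode (n, xs)))"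
abbreviation instr_test :: "nat \<Rightarrow> nat \<Rightarrow> nat \<Rightarrow> nat" where
  "instr_test p n xs \<equiv> prod_encode (4, prod_encode (p, prod_encode (n, xs)))"

definition step_eval :: "nat \<Rightarrow> nat \<Rightarrow> nat \<Rightarrow> nat \<Rightarrow> nat" where
  "step_eval p xs k vs =
    (if pfst p = 0 then prod_encode (k, list_cons 0 vs)
     else if pfst p = 1 then prod_encode (k, list_cons (Suc (list_hd xs)) vs)
     else if pfst p = 2 then prod_encode (k, list_cons (list_hd ((list_tl ^^ psnd p) xs)) vs)
     else if pfst p = 3 then prod_encode
       (list_cons (instr_eval_list (psnd (psnd p)) xs) (list_cons (instr_call (pfst (psnd p)) vs) k), 0)
     else if pfst p = 4 then
       (if list_hd xs = 0 then prod_encode (list_cons (instr_eval (pfst (psnd p)) (list_tl xs)) k, vs)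
        else prod_encode
          (list_cons (instr_eval p (list_cons (list_hd xs - 1) (list_tl xs)))
            (list_cons (instr_primrec (psnd (psnd p)) (list_hd xs - 1) (list_tl xs)) k), vs))
     else prod_encode
       (list_cons (instr_eval (psnd p) (list_cons 0 xs)) (list_cons (instr_test (psnd p) 0 xs) k), vs))"

definition step_instr :: "nat \<Rightarrow> nat \<Rightarrow> nat \<Rightarrow> nat" where
  "step_instr i k vs =
    (if pfst i = 0 then step_eval (pfst (psnd i)) (psnd (psnd i)) k vs
     else if pfst i = 1 then
       (if pfst (psnd i) = 0 then prod_encode (k, vs)
        else prod_encode
          (list_cons (instr_eval_list (list_tl (pfst (psnd i))) (psnd (psnd i)))
            (list_cons (instr_eval (list_hd (pfst (psnd i))) (psnd (psnd i))) k), vs))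
     else if pfst i = 2 then
       prod_encode (list_cons (instr_eval (pfst (psnd i)) vs) k, psnd (psnd i))
     else if pfst i = 3 then prod_encode
       (list_cons (instr_eval (pfst (psnd i))
         (list_cons (pfst (psnd (psnd i))) (list_cons (list_hd vs) (psnd (psnd (psnd i)))))) k, list_tl vs)
     else if list_hd vs = 0 then prod_encode (k, list_cons (pfst (psnd (psnd i))) (list_tl vs))
     else prod_encode
       (list_cons (instr_eval (pfst (psnd i)) (list_cons (Suc (pfst (psnd (psnd i)))) (psnd (psnd (psnd i)))))
         (list_cons (instr_test (pfst (psnd i)) (Suc (pfst (psnd (psnd i)))) (psnd (psnd (psnd i)))) k),
        list_tl vs))"

definition machine_step :: "nat \<Rightarrow> nat" where
  "machine_step c = (if pfst c = 0 then c else step_instr (list_hd (pfst c)) (list_tl (pfst c)) (psnd c))"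

definition machine_run :: "nat \<Rightarrow> nat \<Rightarrow> nat \<Rightarrow> nat" where
  "machine_run p x s = (machine_step ^^ s) (prod_encode (list_cons (instr_eval p (list_cons x 0)) 0, 0))"

text \<open>The result \<open>0\<close> stands for a computation that is still running; \<open>Suc y\<close> for the output \<open>y\<close>.\<close>

definition run_steps :: "nat \<Rightarrow> nat \<Rightarrow> nat \<Rightarrow> nat" where
  "run_steps p x s = (if pfst (machine_run p x s) = 0 then Suc (list_hd (psnd (machine_run p x s))) else 0)"

lemma recursive_step_eval:
  assumes "total_recursive p" "total_recursive xs" "total_recursive k" "total_recursive vs"
  shows "total_recursive (\<lambda>z. step_eval (p z) (xs z) (k z) (vs z))"
  unfolding step_eval_def by (intro recursive_intros assms)

lemma recursive_step_instr:
  assumes "total_recursive i" "total_recursive k" "total_recursive vs"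
  shows "total_recursive (\<lambda>z. step_instr (i z) (k z) (vs z))"
  unfolding step_instr_def by (intro recursive_intros recursive_step_eval assms)

lemma recursive_machine_step: "total_recursive f \<Longrightarrow> total_recursive (\<lambda>z. machine_step (f z))"
  unfolding machine_step_def by (intro recursive_intros recursive_step_instr)

lemma recursive_run_steps [recursive_intros]:
  assumes "total_recursive p" "total_recursive x" "total_recursive s"
  shows "total_recursive (\<lambda>z. run_steps (p z) (x z) (s z))"
  unfolding run_steps_def machine_run_def by (intro recursive_intros recursive_machine_step assms)

definition reaches :: "nat \<Rightarrow> nat \<Rightarrow> bool" where
  "reaches c c' \<longleftrightarrow> (\<exists>s. (machine_step ^^ s) c = c')"

lemma reaches_refl: "reaches c c"
  unfolding reaches_def by (rule exI[of _ 0]) simp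

lemma reaches_trans [trans]: "reaches a b \<Longrightarrow> reaches b c \<Longrightarrow> reaches a c"
  unfolding reaches_def by (metis funpow_add comp_apply)

lemma reaches_step: "reaches (machine_step c) c' \<Longrightarrow> reaches c c'"
  unfolding reaches_def by (metis funpow_swap1 funpow.simps(2) comp_apply)

lemma reaches_instr: "reaches (step_instr i k vs) c \<Longrightarrow> reaches (prod_encode (list_cons i k, vs)) c"
  by (rule reaches_step) (simp add: machine_step_def)

text \<open>Evaluating the last program first leaves the results on the value list in the right order.\<close>

lemma machine_eval_list:
  assumes "list_all2 (\<lambda>g y. \<forall>k vs. reaches (prod_encode (list_cons (instr_eval (recf_code g) xs) k, vs))
      (prod_encode (k, list_cons y vs))) gs ys"
  shows "reaches (prod_encode (list_cons (instr_eval_list (list_encode (map recf_code gs)) xs) k, list_encode vs))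
      (prod_encode (k, list_encode (ys @ vs)))"
  using assms
proof (induction gs ys arbitrary: k rule: list_all2_induct)
  case Nil
  show ?case by (rule reaches_instr) (simp add: step_instr_def reaches_refl)
next
  case (Cons g gs y ys)
  let ?k = "list_cons (instr_eval (recf_code g) xs) k"
  have "reaches (prod_encode (?k, list_encode (ys @ vs))) (prod_encode (k, list_encode ((y # ys) @ vs)))"
    using Cons.hyps(1) by simp
  with Cons.IH[of ?k] show ?case
    by (intro reaches_instr) (auto simp: step_instr_def intro: reaches_trans)
qed

lemma machine_test:
  assumes "\<And>k vs. reaches (prod_encode (list_cons (instr_eval p (list_cons n xs)) k, vs)) (prod_encode (k, list_cons 0 vs))"
    and "\<And>m k vs. m < n \<Longrightarrow> \<exists>v. reaches (prod_encode (list_cons (instr_eval p (list_cons m xs)) k, vs))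
            (prod_encode (k, list_cons (Suc v) vs))"
    and "m \<le> n"
  shows "reaches (prod_encode (list_cons (instr_eval p (list_cons m xs)) (list_cons (instr_test p m xs) k), vs))
      (prod_encode (k, list_cons n vs))"
  using assms(3)
proof (induction m rule: inc_induct)
  case base
  show ?case
    by (rule reaches_trans[OF assms(1)], rule reaches_instr) (simp add: step_instr_def reaches_refl)
next
  case (step m)
  obtain v where "reaches (prod_encode (list_cons (instr_eval p (list_cons m xs)) (list_cons (instr_test p m xs) k), vs))
      (prod_encode (list_cons (instr_test p m xs) k, list_cons (Suc v) vs))"
    using assms(2) step.hyps by blast
  then show ?case
    by (rule reaches_trans, intro reaches_instr) (use step.IH in \<open>simp add: step_instr_def\<close>)
qed

lemma machine_evaluates:
  assumes "evaluates p xs y"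
  shows "reaches (prod_encode (list_cons (instr_eval (recf_code p) (list_encode xs)) k, vs))
      (prod_encode (k, list_cons y vs))"
  using assms
proof (induction arbitrary: k vs rule: evaluates.induct)
  case (evaluates_Zero xs)
  show ?case by (rule reaches_instr) (simp add: step_instr_def step_eval_def reaches_refl)
next
  case (evaluates_Succ x)
  show ?case by (rule reaches_instr) (simp add: step_instr_def step_eval_def reaches_refl)
next
  case (evaluates_Proj i xs)
  then show ?case
    by (intro reaches_instr) (simp add: step_instr_def step_eval_def list_nth[simplified] reaches_refl)
next
  case (evaluates_Comp xs gs ys f z)
  let ?call = "list_cons (instr_call (recf_code f) vs) k"
  have "reaches (prod_encode (list_cons (instr_eval_list (list_encode (map recf_code gs)) (list_encode xs)) ?call, list_encode []))
      (prod_encode (?call, list_encode (ys @ [])))"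
    by (rule machine_eval_list, rule list.rel_mono_strong[OF evaluates_Comp.IH(1)]) blast
  moreover have "reaches (prod_encode (?call, list_encode ys)) (prod_encode (k, list_cons z vs))"
    by (rule reaches_instr) (use evaluates_Comp.IH(2) in \<open>simp add: step_instr_def\<close>)
  ultimately have "reaches (prod_encode (list_cons (instr_eval_list (list_encode (map recf_code gs)) (list_encode xs)) ?call, 0))
     (prod_encode (k, list_cons z vs))"
    by (auto intro: reaches_trans)
  then show ?case by (intro reaches_instr) (simp add: step_instr_def step_eval_def)
next
  case (evaluates_PrimRec_0 f xs z g)
  then show ?case by (intro reaches_instr) (simp add: step_instr_def step_eval_def)
next
  case (evaluates_PrimRec_Suc f g n xs y z)
  let ?cont = "list_cons (instr_primrec (recf_code g) n (list_encode xs)) k"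
  have "reaches (prod_encode (?cont, list_cons y vs)) (prod_encode (k, list_cons z vs))"
    by (rule reaches_instr) (use evaluates_PrimRec_Suc.IH(2) in \<open>simp add: step_instr_def\<close>)
  with evaluates_PrimRec_Suc.IH(1)[of ?cont vs] show ?case
    by (intro reaches_instr) (auto simp: step_instr_def step_eval_def intro: reaches_trans)
next
  case (evaluates_Mu f n xs)
  have "reaches (prod_encode (list_cons (instr_eval (recf_code f) (list_cons 0 (list_encode xs)))
          (list_cons (instr_test (recf_code f) 0 (list_encode xs)) k), vs))
      (prod_encode (k, list_cons n vs))"
  proof (rule machine_test)
    fix m k vs assume "m < n"
    then show "\<exists>v. reaches (prod_encode (list_cons (instr_eval (recf_code f) (list_cons m (list_encode xs))) k, vs))
        (prod_encode (k, list_cons (Suc v) vs))"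
      using evaluates_Mu.IH(2) by fastforce
  qed (use evaluates_Mu.IH(1) in auto)
  then show ?case by (intro reaches_instr) (simp add: step_instr_def step_eval_def)
qed

text \<open>A machine without pending instructions does not move any more.\<close>

lemma run_steps_mono:
  assumes "run_steps p x s \<noteq> 0" "s \<le> s'"
  shows "run_steps p x s' = run_steps p x s"
proof -
  have "machine_run p x s' = machine_run p x s"
    using assms(2)
  proof (induction rule: dec_induct)
    case (step s')
    then show ?case using assms(1) by (simp add: machine_run_def machine_step_def run_steps_def split: if_splits)
  qed simp
  then show ?thesis by (simp add: run_steps_def)
qed

lemma run_steps_complete:
  assumes "total_recursive g"
  obtains p where "\<And>x. \<exists>s. run_steps p x s = Suc (g x)"
proof -
  obtain q where q: "\<And>x. evaluates q [x] (g x)" using assms unfolding total_recursive_def by blast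
  have "\<exists>s. run_steps (recf_code q) x s = Suc (g x)" for x
  proof -
    have "reaches (prod_encode (list_cons (instr_eval (recf_code q) (list_encode [x])) 0, 0)) (prod_encode (0, list_cons (g x) 0))"
      by (rule machine_evaluates[OF q])
    then obtain s where "machine_run (recf_code q) x s = prod_encode (0, list_cons (g x) 0)"
      unfolding reaches_def machine_run_def by auto
    then have "run_steps (recf_code q) x s = Suc (g x)" by (simp add: run_steps_def)
    then show ?thesis ..
  qed
  then show thesis by (rule that)
qed

section \<open>The token construction\<close>

abbreviation label_of :: "nat \<Rightarrow> nat" where "label_of c \<equiv> pfst c"
abbreviation place_of :: "nat \<Rightarrow> nat" where "place_of c \<equiv> psnd c"

text \<open>
  A requirement is a number \<open>e\<close> that codes a program \<open>p = pfst e\<close> and a label \<open>r = psnd e\<close>. On input a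
  token \<open>n\<close>, the program is meant to output whether \<open>n\<close> is labelled in the source set \<open>S\<close>, whether it is
  labelled in the target set \<open>T\<close>, and its image under the alleged reduction; \<open>r\<close> is meant to be in
  \<open>S - T\<close>. As \<open>S\<close> and \<open>T\<close> are only known through the program, the construction needs no enumeration
  of the recursive sets. The next definitions read these data off after \<open>s\<close> steps, and have meaning
  only if the program has stopped by then. That the image is below \<open>s\<close> means
  that it has already been placed.
\<close>

definition in_src :: "nat \<Rightarrow> nat \<Rightarrow> nat \<Rightarrow> bool" where
  "in_src p s n \<longleftrightarrow> pfst (run_steps p n s - 1) \<noteq> 0"
definition in_tgt :: "nat \<Rightarrow> nat \<Rightarrow> nat \<Rightarrow> bool" where
  "in_tgt p s n \<longleftrightarrow> pfst (psnd (run_steps p n s - 1)) \<noteq> 0"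
definition img :: "nat \<Rightarrow> nat \<Rightarrow> nat \<Rightarrow> nat" where
  "img p s n = psnd (psnd (run_steps p n s - 1))"
definition converged :: "nat \<Rightarrow> nat \<Rightarrow> nat \<Rightarrow> bool" where
  "converged p s n \<longleftrightarrow> run_steps p n s \<noteq> 0 \<and> img p s n < s"

definition settled :: "(nat \<Rightarrow> nat) \<Rightarrow> nat \<Rightarrow> nat \<Rightarrow> nat \<Rightarrow> bool" where
  "settled \<tau> p s b \<longleftrightarrow> (\<forall>n<s. place_of (\<tau> n) < b \<longrightarrow> converged p s n)"

text \<open>
  The set coded by \<open>d\<close> looks closed for the requirement, and nothing seen on it shows that the
  requirement is ill-formed. The injectivity clause makes the \<open>T\<close>-tokens on the set bound the
  number of \<open>S\<close>-tokens, and the clause on \<open>r\<close> makes every added token raise the number of \<open>S\<close>-tokens alone.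
\<close>

definition closed_under :: "(nat \<Rightarrow> nat) \<Rightarrow> nat \<Rightarrow> nat \<Rightarrow> nat \<Rightarrow> nat \<Rightarrow> bool" where
  "closed_under \<tau> p r s d \<longleftrightarrow> (\<forall>n<s. place_of (\<tau> n) \<in> set_decode d \<longrightarrow>
     (label_of (\<tau> n) = r \<longrightarrow> in_src p s n \<and> \<not> in_tgt p s n) \<and>
     (in_src p s n \<longrightarrow>
        img p s n < s \<and> place_of (\<tau> (img p s n)) \<in> set_decode d \<and> in_tgt p s (img p s n) \<and>
        (\<forall>k<s. place_of (\<tau> k) \<in> set_decode d \<and> in_src p s k \<and> img p s k = img p s n \<longrightarrow> k = n)))"

text \<open>
  At place \<open>y\<close> a requirement attends if a closed set with maximum \<open>y\<close> asks for a new token. It waits if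
  its program is still running on a token at \<open>y\<close>, although it has stopped on everything below. While it
  waits, a token of lower priority at \<open>y\<close> might spoil its count; so both conditions block lower
  requirements.
\<close>

definition attends :: "(nat \<Rightarrow> nat) \<Rightarrow> nat \<Rightarrow> nat \<Rightarrow> nat \<Rightarrow> bool" where
  "attends \<tau> e s y \<longleftrightarrow> settled \<tau> (pfst e) s (Suc y) \<and>
     (\<exists>d<2 ^ Suc y. y \<in> set_decode d \<and> closed_under \<tau> (pfst e) (psnd e) s d)"

definition waits :: "(nat \<Rightarrow> nat) \<Rightarrow> nat \<Rightarrow> nat \<Rightarrow> nat \<Rightarrow> bool" where
  "waits \<tau> e s y \<longleftrightarrow> settled \<tau> (pfst e) s y \<and> \<not> settled \<tau> (pfst e) s (Suc y)"

definition acts :: "(nat \<Rightarrow> nat) \<Rightarrow> nat \<Rightarrow> nat \<Rightarrow> nat \<Rightarrow> bool" where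
  "acts \<tau> e s y \<longleftrightarrow> attends \<tau> e s y \<and> (\<forall>e'<e. \<not> attends \<tau> e' s y \<and> \<not> waits \<tau> e' s y)"

text \<open>
  Stages with first component \<open>0\<close> place the base tokens, and those with first component \<open>Suc y\<close> serve
  place \<open>y\<close>. A stage without a requirement to serve has to place some token: it puts a further base
  token on the place \<open>s\<close>, which receives only one token in this way. Base tokens have the
  label \<open>0\<close>.
\<close>

definition next_token :: "(nat \<Rightarrow> nat) \<Rightarrow> nat \<Rightarrow> nat" where
  "next_token \<tau> s =
    (if pfst s = 0 then prod_encode (0, psnd s)
     else if (LEAST e. pfst s \<le> e \<or> acts \<tau> e s (pfst s - 1)) < pfst s
       then prod_encode (psnd (LEAST e. pfst s \<le> e \<or> acts \<tau> e s (pfst s - 1)), pfst s - 1)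
     else prod_encode (0, s))"

fun token :: "nat \<Rightarrow> nat" where
  "token s = next_token (\<lambda>n. if n < s then token n else 0) s"

declare token.simps [simp del]

lemma recursive_token: "total_recursive token"
proof (rule recursive_course_of_values)
  show "token s = next_token (\<lambda>n. if n < s then token n else 0) s" for s
    by (rule token.simps)
  show "total_recursive (\<lambda>z. next_token (\<lambda>n. if n < psnd z
      then list_hd ((list_tl ^^ (psnd z - Suc n)) (pfst z)) else 0) (psnd z))"
    unfolding next_token_def acts_def attends_def waits_def settled_def closed_under_def
      converged_def in_src_def in_tgt_def img_def
    by (intro recursive_intros; (rule exI, rule disjI1, rule order_refl)?)
qed

text \<open>
  Stage \<open>s\<close> inspects only the tokens below \<open>s\<close>, so the cut-off function in the recursion equation can be
  replaced by \<open>token\<close> itself.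
\<close>

lemma next_token_local:
  assumes "\<And>n. n < s \<Longrightarrow> \<tau> n = \<sigma> n"
  shows "next_token \<tau> s = next_token \<sigma> s"
proof -
  have settled: "settled \<tau> p s b = settled \<sigma> p s b" for p b
    using assms by (simp add: settled_def)
  have closed: "closed_under \<tau> p r s d = closed_under \<sigma> p r s d" for p r d
    unfolding closed_under_def using assms by (auto 0 4)
  show ?thesis
    by (simp add: next_token_def acts_def attends_def waits_def settled closed)
qed

lemma token_unfold: "token s = next_token token s"
  by (subst token.simps, rule next_token_local) simp

lemma base_token: "token (prod_encode (0, x)) = prod_encode (0, x)"
  by (simp add: token_unfold next_token_def)

lemma token_place_cases:
  assumes "place_of (token s) = y"
  shows "s = y \<or> s = prod_encode (0, y) \<or> (pfst s = Suc y \<and> (\<exists>e\<le>y. acts token e s y))"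
proof (cases "pfst s")
  case 0
  then have "s = prod_encode (0, psnd s)" by (metis prod.collapse prod_decode_inverse)
  with 0 assms show ?thesis by (simp add: token_unfold[of s] next_token_def)
next
  case (Suc x)
  let ?e = "LEAST e. pfst s \<le> e \<or> acts token e s (pfst s - 1)"
  show ?thesis
  proof (cases "?e < pfst s")
    case True
    then have "x = y" using assms Suc by (simp add: token_unfold[of s] next_token_def)
    have "pfst s \<le> ?e \<or> acts token ?e s (pfst s - 1)" by (rule LeastI[of _ "pfst s"]) simp
    with True Suc \<open>x = y\<close> show ?thesis by auto
  next
    case False
    with assms Suc show ?thesis by (simp add: token_unfold[of s] next_token_def)
  qed
qed

lemma acts_token:
  assumes "pfst s = Suc y" "e \<le> y" "acts token e s y"
  shows "token s = prod_encode (psnd e, y)"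
proof -
  have "(LEAST e. pfst s \<le> e \<or> acts token e s (pfst s - 1)) = e"
    by (rule Least_equality) (use assms in \<open>auto simp: acts_def not_less[symmetric]\<close>)
  then show ?thesis using assms by (simp add: token_unfold[of s] next_token_def)
qed

lemma converged_stable:
  assumes "converged p s n" "s \<le> s'"
  shows "in_src p s' n = in_src p s n" "in_tgt p s' n = in_tgt p s n" "img p s' n = img p s n"
    "converged p s' n"
proof -
  have "run_steps p n s' = run_steps p n s"
    using assms by (intro run_steps_mono) (auto simp: converged_def)
  then show "in_src p s' n = in_src p s n" "in_tgt p s' n = in_tgt p s n" "img p s' n = img p s n"
    "converged p s' n"
    using assms by (auto simp: in_src_def in_tgt_def img_def converged_def)
qed

lemma set_decode_less:
  assumes "x \<in> set_decode d" "d < 2 ^ b"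
  shows "x < b"
proof (rule ccontr)
  assume "\<not> x < b"
  then have "(2::nat) ^ b \<le> 2 ^ x" by simp
  with assms(2) have "d < 2 ^ x" by (rule less_le_trans)
  then have "d div 2 ^ x = 0" by simp
  with assms(1) show False by (simp add: set_decode_def)
qed

lemma set_encode_less:
  assumes "D \<subseteq> {..<b}"
  shows "set_encode D < 2 ^ b"
proof -
  have "set_encode D \<le> (\<Sum>i\<in>{0..<b}. 2 ^ i)"
    unfolding set_encode_def using assms by (intro sum_mono2) auto
  also have "\<dots> = 2 ^ b - 1" by (rule sum_power2)
  also have "\<dots> < 2 ^ b" by simp
  finally show ?thesis .
qed

text \<open>
  Everything that shows a settled set not to be closed is a finished computation, so it remains valid at
  all later stages, whatever tokens are added. So a requirement that is settled at \<open>y\<close> without attending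
  there never attends there again.
\<close>

lemma closed_under_antimono:
  assumes set: "settled token p s (Suc y)" and d: "d < 2 ^ Suc y" and "s \<le> s'"
    and closed: "closed_under token p r s' d"
  shows "closed_under token p r s d"
proof -
  have conv: "converged p s n" if "n < s" "place_of (token n) \<in> set_decode d" for n
    using set set_decode_less[OF that(2) d] that(1) by (simp add: settled_def)
  note stable = converged_stable[OF conv \<open>s \<le> s'\<close>]
  show ?thesis unfolding closed_under_def
  proof (intro allI impI conjI)
    fix n assume n: "n < s" "place_of (token n) \<in> set_decode d"
    have n': "n < s'" using n \<open>s \<le> s'\<close> by simp
    note c = closed[unfolded closed_under_def, rule_format, OF n' n(2)]
    { assume "label_of (token n) = r"
      then show "in_src p s n" "\<not> in_tgt p s n" using c stable[OF n] by auto }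
    assume src: "in_src p s n"
    show i: "img p s n < s" using conv[OF n] by (simp add: converged_def)
    show i': "place_of (token (img p s n)) \<in> set_decode d" using c stable[OF n] src by auto
    show "in_tgt p s (img p s n)" using c stable[OF n] stable[OF i i'] src by auto
    fix k assume k: "k < s" "place_of (token k) \<in> set_decode d \<and> in_src p s k \<and> img p s k = img p s n"
    then show "k = n" using c stable[OF n] stable[OF k(1)] src \<open>s \<le> s'\<close> by auto
  qed
qed

text \<open>
  By induction on the place \<open>y\<close> and then on the index \<open>e\<close>. When the places below \<open>y\<close> and the
  requirements before \<open>e\<close> have come to rest, and \<open>e\<close> is still going to act infinitely often, no later
  requirement can act at \<open>y\<close>: it would be let through only after \<open>e\<close> is satisfied for good. So all further
  tokens on sets with maximum \<open>y\<close> are those of \<open>e\<close>. They count as source tokens and not as target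
  tokens, and finally outnumber the latter on a closed set.
\<close>

lemma finite_place: "finite {n. place_of (token n) = y}"
proof (induction y rule: less_induct)
  case (less y)
  define Acts where "Acts e = {s. pfst s = Suc y \<and> e \<le> y \<and> acts token e s y}" for e
  have fin_below: "finite {n. place_of (token n) < y}"
  proof -
    have "{n. place_of (token n) < y} = (\<Union>z<y. {n. place_of (token n) = z})" by auto
    with less.IH show ?thesis by simp
  qed
  have "finite (Acts e)" for e
  proof (induction e rule: less_induct)
    case (less e)
    show ?case
    proof (rule ccontr)
      assume inf: "infinite (Acts e)"
      have "finite ({y, prod_encode (0, y)} \<union> {n. place_of (token n) < y} \<union> (\<Union>e'<e. Acts e'))"
        using fin_below less.IH by simp
      then obtain s\<^sub>0 where s\<^sub>0: "({y, prod_encode (0, y)} \<union> {n. place_of (token n) < y} \<union> (\<Union>e'<e. Acts e')) \<subseteq> {..<s\<^sub>0}"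
        by (metis finite_nat_iff_bounded)
      have later: "\<exists>s\<ge>b. s \<in> Acts e" for b
        using inf by (meson infinite_nat_iff_unbounded_le)
      obtain s\<^sub>1 where s\<^sub>1: "s\<^sub>1 \<ge> s\<^sub>0" "s\<^sub>1 \<in> Acts e" using later by blast
      \<comment> \<open>The places below \<open>y\<close> are final, so what was settled when \<open>e\<close> acted stays settled.\<close>
      have below: "settled token (pfst e) s y" if "s \<ge> s\<^sub>1" for s
        unfolding settled_def
      proof (intro allI impI)
        fix n assume n: "n < s" "place_of (token n) < y"
        then have "n < s\<^sub>1" using s\<^sub>0 s\<^sub>1(1) by force
        then have "converged (pfst e) s\<^sub>1 n"
          using s\<^sub>1(2) n(2) by (simp add: Acts_def acts_def attends_def settled_def)
        then show "converged (pfst e) s n" using that by (rule converged_stable)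
      qed
      have others: "s \<notin> Acts e'" if "s \<ge> s\<^sub>1" "e < e'" for s e'
      proof
        assume "s \<in> Acts e'"
        with \<open>e < e'\<close> have no: "\<not> attends token e s y" "\<not> waits token e s y"
          by (auto simp: Acts_def acts_def)
        with below[OF that(1)] have set: "settled token (pfst e) s (Suc y)" by (simp add: waits_def)
        obtain s\<^sub>2 where s\<^sub>2: "s\<^sub>2 \<ge> s" "s\<^sub>2 \<in> Acts e" using later by blast
        then obtain d where d: "d < 2 ^ Suc y" "y \<in> set_decode d"
            "closed_under token (pfst e) (psnd e) s\<^sub>2 d"
          unfolding Acts_def acts_def attends_def by blast
        have "closed_under token (pfst e) (psnd e) s d"
          by (rule closed_under_antimono[OF set d(1) s\<^sub>2(1) d(3)])
        with set d no(1) show False by (auto simp: attends_def)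
      qed
      have only: "n \<in> Acts e" if "n \<ge> s\<^sub>1" "place_of (token n) \<le> y" for n
      proof -
        have "n \<ge> s\<^sub>0" using that s\<^sub>1(1) by simp
        then have "\<not> place_of (token n) < y" "n \<noteq> y" "n \<noteq> prod_encode (0, y)" "\<And>e'. e' < e \<Longrightarrow> n \<notin> Acts e'"
          using s\<^sub>0 by force+
        moreover from this that token_place_cases[of n y] obtain e' where "n \<in> Acts e'"
          by (auto simp: Acts_def)
        ultimately show ?thesis using others[OF that(1), of e'] by (metis linorder_neqE_nat)
      qed
      have tok: "token n = prod_encode (psnd e, y)" if "n \<in> Acts e" for n
        using that acts_token unfolding Acts_def by blast
      \<comment> \<open>The tokens of more than \<open>s\<^sub>1\<close> later actions are mapped injectively below \<open>s\<^sub>1\<close>.\<close>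
      have "infinite (Acts e - {..<s\<^sub>1})" using inf by simp
      then obtain T where T: "T \<subseteq> Acts e - {..<s\<^sub>1}" "finite T" "card T = Suc s\<^sub>1"
        using infinite_arbitrarily_large by metis
      obtain b where b: "T \<subseteq> {..<b}" using T(2) by (metis finite_nat_iff_bounded)
      obtain s\<^sub>2 where s\<^sub>2: "s\<^sub>2 \<ge> b" "s\<^sub>2 \<in> Acts e" using later by blast
      then obtain d where d: "d < 2 ^ Suc y" "y \<in> set_decode d"
          "closed_under token (pfst e) (psnd e) s\<^sub>2 d"
        unfolding Acts_def acts_def attends_def by blast
      note c = d(3)[unfolded closed_under_def, rule_format]
      have T_src: "n < s\<^sub>2 \<and> place_of (token n) \<in> set_decode d \<and> in_src (pfst e) s\<^sub>2 n" if "n \<in> T" for n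
      proof -
        have n: "n < s\<^sub>2" "token n = prod_encode (psnd e, y)"
          using that b s\<^sub>2(1) T(1) tok by force+
        with c[OF n(1)] d(2) show ?thesis by simp
      qed
      have "img (pfst e) s\<^sub>2 ` T \<subseteq> {..<s\<^sub>1}"
      proof (intro subsetI; elim imageE)
        fix m n assume m: "m = img (pfst e) s\<^sub>2 n" and n: "n \<in> T"
        have i: "m < s\<^sub>2" "place_of (token m) \<in> set_decode d" "in_tgt (pfst e) s\<^sub>2 m"
          using c[of n] T_src[OF n] by (auto simp: m)
        have "m < s\<^sub>1"
        proof (rule ccontr)
          assume "\<not> m < s\<^sub>1"
          then have "m \<in> Acts e" using only[of m] set_decode_less[OF i(2) d(1)] by simp
          with c[OF i(1,2)] i(3) tok show False by simp
        qed
        then show "m \<in> {..<s\<^sub>1}" by simp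
      qed
      moreover have "inj_on (img (pfst e) s\<^sub>2) T"
      proof (rule inj_onI)
        fix k n assume kn: "k \<in> T" "n \<in> T" "img (pfst e) s\<^sub>2 k = img (pfst e) s\<^sub>2 n"
        then show "k = n" using c[of n] T_src[OF kn(1)] T_src[OF kn(2)] by blast
      qed
      ultimately have "card T \<le> card {..<s\<^sub>1}" by (metis card_inj_on_le finite_lessThan)
      with T(3) show False by simp
    qed
  qed
  moreover have "{n. place_of (token n) = y} \<subseteq> {y, prod_encode (0, y)} \<union> (\<Union>e\<le>y. Acts e)"
    using token_place_cases by (auto simp: Acts_def)
  ultimately show ?case by (metis (no_types, lifting) finite.emptyI finite.insertI finite_UN finite_Un finite_atMost finite_subset)
qed

text \<open>
  If the program diverges on some token, then above the place of this token the
  requirement no longer counts as settled below, so it does not wait there.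
\<close>

lemma eventually_not_waits:
  "\<exists>N. \<forall>y\<ge>N. \<forall>\<^sub>F s in sequentially. \<not> waits token e s y"
proof (cases "\<forall>n. \<exists>s. converged (pfst e) s n")
  case True
  have "\<forall>\<^sub>F s in sequentially. \<not> waits token e s y" for y
  proof -
    have "{n. place_of (token n) < Suc y} = (\<Union>z\<le>y. {n. place_of (token n) = z})" by auto
    then have fin: "finite {n. place_of (token n) < Suc y}" using finite_place by simp
    have "\<forall>\<^sub>F s in sequentially. \<forall>n\<in>{n. place_of (token n) < Suc y}. converged (pfst e) s n"
    proof (intro eventually_ball_finite fin ballI)
      fix n
      obtain s where "converged (pfst e) s n" using True by blast
      then show "\<forall>\<^sub>F s in sequentially. converged (pfst e) s n"
        unfolding eventually_sequentially by (intro exI[of _ s]) (auto intro: converged_stable)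
    qed
    then show ?thesis by eventually_elim (auto simp: waits_def settled_def)
  qed
  then show ?thesis by blast
next
  case False
  then obtain n where n: "\<And>s. \<not> converged (pfst e) s n" by blast
  have "\<not> waits token e s y" if "y \<ge> Suc (place_of (token n))" "s \<ge> Suc n" for s y
    using that n by (auto simp: waits_def settled_def intro!: exI[of _ n])
  then show ?thesis unfolding eventually_sequentially by blast
qed

text \<open>
  If \<open>D\<close> were closed in the limit, with a maximum \<open>y\<close> beyond all places blocked by earlier
  requirements, then the requirement would attend at \<open>y\<close> at almost all stages. So at each late stage
  that serves \<open>y\<close> either this requirement or an earlier one would act, and \<open>y\<close> would receive infinitely
  many tokens.
\<close>

lemma requirement_met:
  assumes prog: "\<And>n. \<exists>s. run_steps p n s =
        Suc (prod_encode (of_bool (n \<in> src), prod_encode (of_bool (n \<in> tgt), g n)))"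
    and lab: "\<And>n. label_of (token n) = r \<Longrightarrow> n \<in> src \<and> n \<notin> tgt"
    and maps: "g ` src \<subseteq> tgt" and inj: "inj_on g src"
  shows "\<exists>N. \<forall>D. finite D \<longrightarrow> (\<exists>x\<in>D. N \<le> x) \<longrightarrow>
    (\<exists>n\<in>src. place_of (token n) \<in> D \<and> place_of (token (g n)) \<notin> D)"
proof -
  define e where "e = prod_encode (p, r)"
  define good where "good n s \<longleftrightarrow> converged p s n \<and> (in_src p s n \<longleftrightarrow> n \<in> src) \<and> (in_tgt p s n \<longleftrightarrow> n \<in> tgt) \<and> img p s n = g n" for n s
  have good: "\<forall>\<^sub>F s in sequentially. good n s" for n
  proof -
    obtain s\<^sub>0 where s\<^sub>0: "run_steps p n s\<^sub>0 =
        Suc (prod_encode (of_bool (n \<in> src), prod_encode (of_bool (n \<in> tgt), g n)))"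
      using prog by blast
    have "good n s" if "s \<ge> max s\<^sub>0 (Suc (g n))" for s
    proof -
      have "run_steps p n s = run_steps p n s\<^sub>0" using that s\<^sub>0 by (intro run_steps_mono) auto
      then show ?thesis using s\<^sub>0 that by (simp add: good_def converged_def in_src_def in_tgt_def img_def)
    qed
    then show ?thesis unfolding eventually_sequentially by blast
  qed
  have "\<forall>\<^sub>F N in sequentially. \<forall>e'\<in>{..<e}. \<forall>y\<ge>N. \<forall>\<^sub>F s in sequentially. \<not> waits token e' s y"
  proof (intro eventually_ball_finite ballI)
    fix e'
    obtain N where "\<forall>y\<ge>N. \<forall>\<^sub>F s in sequentially. \<not> waits token e' s y"
      using eventually_not_waits by blast
    then show "\<forall>\<^sub>F N in sequentially. \<forall>y\<ge>N. \<forall>\<^sub>F s in sequentially. \<not> waits token e' s y"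
      unfolding eventually_sequentially[where P = "\<lambda>N. \<forall>y\<ge>N. P N y" for P] by (meson order_trans)
  qed simp
  then obtain N where N: "\<And>e' y. e' < e \<Longrightarrow> N \<le> y \<Longrightarrow> \<forall>\<^sub>F s in sequentially. \<not> waits token e' s y"
    unfolding eventually_sequentially[where P = "\<lambda>N. \<forall>e'\<in>{..<e}. P N e'" for P] by blast
  have "\<exists>n\<in>src. place_of (token n) \<in> D \<and> place_of (token (g n)) \<notin> D"
    if fin: "finite D" and x: "x \<in> D" "max e N \<le> x" for D x
  proof (rule ccontr)
    assume "\<not> ?thesis"
    then have stay: "place_of (token (g n)) \<in> D" if "n \<in> src" "place_of (token n) \<in> D" for n
      using that by blast
    define y where "y = Max D"
    have y: "y \<in> D" "D \<subseteq> {..<Suc y}" "e \<le> y" "N \<le> y"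
      using Max_in[OF fin] Max_ge[OF fin] x by (auto simp: y_def less_Suc_eq_le dest: order_trans)
    define d where "d = set_encode D"
    have d: "set_decode d = D" "d < 2 ^ Suc y"
      using fin y(2) set_encode_less[of D "Suc y"] by (simp_all add: d_def set_encode_inverse del: power_Suc)
    have "{n. place_of (token n) < Suc y} = (\<Union>z\<le>y. {n. place_of (token n) = z})" by auto
    then have fin_y: "finite {n. place_of (token n) < Suc y}" using finite_place by simp
    have "\<forall>\<^sub>F s in sequentially. \<forall>n\<in>{n. place_of (token n) < Suc y}. good n s"
      by (intro eventually_ball_finite fin_y ballI good)
    then have "\<forall>\<^sub>F s in sequentially. attends token e s y"
    proof eventually_elim
      case (elim s)
      have good_D: "good n s" if "place_of (token n) \<in> D" for n using elim that y(2) by blast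
      have "closed_under token p r s d"
        unfolding closed_under_def d(1)
      proof (intro allI impI conjI)
        fix n assume n: "n < s" "place_of (token n) \<in> D"
        { assume "label_of (token n) = r"
          then show "in_src p s n" "\<not> in_tgt p s n" using lab good_D[OF n(2)] by (auto simp: good_def) }
        assume "in_src p s n"
        then have src: "n \<in> src" using good_D[OF n(2)] by (simp add: good_def)
        show "img p s n < s" using good_D[OF n(2)] by (simp add: good_def converged_def)
        show i: "place_of (token (img p s n)) \<in> D"
          using stay[OF src n(2)] good_D[OF n(2)] by (simp add: good_def)
        show "in_tgt p s (img p s n)"
          using good_D[OF i] good_D[OF n(2)] maps src by (auto simp: good_def)
        fix k assume "k < s" "place_of (token k) \<in> D \<and> in_src p s k \<and> img p s k = img p s n"
        then show "k = n" using good_D[of k] good_D[OF n(2)] src inj by (auto simp: good_def inj_on_def)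
      qed
      moreover have "settled token p s (Suc y)" using elim by (auto simp: settled_def good_def)
      ultimately show ?case using d y(1) by (auto simp: attends_def e_def intro!: exI[of _ d])
    qed
    moreover have "\<forall>\<^sub>F s in sequentially. \<forall>e'\<in>{..<e}. \<not> waits token e' s y"
      using N y(4) by (intro eventually_ball_finite) auto
    ultimately have "\<forall>\<^sub>F s in sequentially. pfst s = Suc y \<longrightarrow> place_of (token s) = y"
    proof eventually_elim
      case (elim s)
      define e' where "e' = (LEAST e. attends token e s y)"
      have e': "attends token e' s y" "e' \<le> e" "\<And>e''. e'' < e' \<Longrightarrow> \<not> attends token e'' s y"
        unfolding e'_def using elim(1) by (auto intro: LeastI Least_le dest: not_less_Least)
      then have "acts token e' s y" using elim(2) by (auto simp: acts_def)
      then show ?case using acts_token[of s y e'] e'(2) y(3) by auto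
    qed
    then obtain s\<^sub>0 where s\<^sub>0: "\<And>s. s \<ge> s\<^sub>0 \<Longrightarrow> pfst s = Suc y \<Longrightarrow> place_of (token s) = y"
      unfolding eventually_sequentially by blast
    obtain b where b: "{n. place_of (token n) = y} \<subseteq> {..<b}"
      using finite_place by (metis finite_nat_iff_bounded)
    define s where "s = prod_encode (Suc y, max s\<^sub>0 b)"
    have "s \<ge> max s\<^sub>0 b" unfolding s_def by (rule le_prod_encode_2)
    moreover have "pfst s = Suc y" by (simp add: s_def)
    ultimately show False using s\<^sub>0[of s] b by fastforce
  qed
  then show ?thesis by blast
qed

section \<open>Cylinders\<close>

lemma decidable_finite: "finite F \<Longrightarrow> decidable (\<lambda>x. x \<in> F)"
proof (induction F rule: finite_induct)
  case (insert a F)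
  then show ?case unfolding insert_iff by (intro recursive_intros)
qed (simp add: recursive_intros)

lemma nonrecursive_unbounded:
  assumes "\<not> recursive_set A"
  shows "\<exists>a\<ge>N. a \<in> A" "\<exists>b\<ge>N. b \<notin> A"
proof -
  have "finite X \<Longrightarrow> \<not> (A = X \<or> A = - X)" for X
    using assms decidable_finite[of X] decidable_not[OF decidable_finite[of X]]
    unfolding recursive_set_def Compl_iff[symmetric] by blast
  then have "infinite A" "infinite (- A)" by (metis double_complement)+
  then show "\<exists>a\<ge>N. a \<in> A" "\<exists>b\<ge>N. b \<notin> A"
    unfolding infinite_nat_iff_unbounded_le by blast+
qed

lemma set_decode_insert:
  assumes "v \<notin> set_decode d"
  shows "set_decode (d + 2 ^ v) = insert v (set_decode d)"
proof -
  have "d + 2 ^ v = set_encode (insert v (set_decode d))"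
    using assms by (simp add: set_encode_insert set_decode_inverse)
  then show ?thesis by (simp add: set_encode_inverse)
qed

lemma cylinder_code: "m \<in> prod_encode ` (A \<times> UNIV) \<longleftrightarrow> pfst m \<in> A"
proof
  assume "pfst m \<in> A"
  moreover have "m = prod_encode (pfst m, psnd m)" by simp
  ultimately show "m \<in> prod_encode ` (A \<times> UNIV)" by blast
qed auto

text \<open>
  Starting with \<open>{x}\<close> and adding fresh elements yields arbitrarily many distinct numbers on the same side
  of \<open>A\<close> as \<open>x\<close>. This suffices for an injection of \<open>A \<times> \<nat>\<close>: the pairs are treated in the order of
  their codes, and each takes the first of its numbers that has not been used before. The finitely many
  \<open>x\<close> below the bound \<open>N\<close> are replaced by fixed larger numbers on the same side, which exist because \<open>A\<close> is
  neither finite nor cofinite.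
\<close>

lemma cylinder_if_fresh:
  assumes nonrec: "\<not> recursive_set A" and new: "total_recursive new"
    and fresh: "\<And>D. finite D \<Longrightarrow> \<exists>x\<in>D. N \<le> x \<Longrightarrow> D \<subseteq> A \<or> D \<inter> A = {} \<Longrightarrow>
      new (set_encode D) \<notin> D \<and> (new (set_encode D) \<in> A \<longleftrightarrow> D \<subseteq> A)"
  shows "cylinder A"
proof -
  obtain a b where ab: "a \<ge> N" "a \<in> A" "b \<ge> N" "b \<notin> A"
    using nonrecursive_unbounded[OF nonrec] by metis
  define start where "start x = (if N \<le> x then x else if x \<in> A \<inter> {..<N} then a else b)" for x
  have start: "start x \<ge> N" "start x \<in> A \<longleftrightarrow> x \<in> A" for x
    using ab by (auto simp: start_def)
  have rec_start: "total_recursive (\<lambda>z. start (h z))" if "total_recursive h" for h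
  proof (rule recursive_comp[OF _ that])
    show "total_recursive start" unfolding start_def
      by (intro recursive_intros decidable_finite) simp
  qed
  have rec_new: "total_recursive (\<lambda>z. new (h z))" if "total_recursive h" for h
    by (rule recursive_comp[OF new that])
  define gen where "gen x j = ((\<lambda>d. d + 2 ^ new d) ^^ j) (2 ^ start x)" for x j
  have rec_gen: "total_recursive (\<lambda>z. gen (h z) (k z))" if "total_recursive h" "total_recursive k" for h k
    unfolding gen_def by (intro recursive_intros rec_start rec_new that)
  have gen_start: "start x \<in> set_decode (gen x j) \<and> (\<forall>y\<in>set_decode (gen x j). y \<in> A \<longleftrightarrow> x \<in> A)"
    and gen_new: "new (gen x j) \<notin> set_decode (gen x j)" "new (gen x j) \<in> A \<longleftrightarrow> x \<in> A" 
    and gen_Suc: "set_decode (gen x (Suc j)) = insert (new (gen x j)) (set_decode (gen x j))" for x j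
  proof -
    have aux: "new d \<notin> set_decode d \<and> (new d \<in> A \<longleftrightarrow> x \<in> A) \<and> set_decode (d + 2 ^ new d) = insert (new d) (set_decode d)"
      if "start x \<in> set_decode d" "\<forall>y\<in>set_decode d. y \<in> A \<longleftrightarrow> x \<in> A" for d
      using that fresh[of "set_decode d"] start[of x] set_decode_insert[of "new d" d]
      by (auto simp: set_decode_inverse)
    have gen_0: "set_decode (gen x 0) = {start x}"
      using set_decode_insert[of "start x" 0] by (simp add: gen_def)
    have step: "gen x (Suc j) = gen x j + 2 ^ new (gen x j)" for j by (simp add: gen_def)
    show 1: "start x \<in> set_decode (gen x j) \<and> (\<forall>y\<in>set_decode (gen x j). y \<in> A \<longleftrightarrow> x \<in> A)" for j
      by (induction j) (use gen_0 start[of x] aux step in auto)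
    show "new (gen x j) \<notin> set_decode (gen x j)" "new (gen x j) \<in> A \<longleftrightarrow> x \<in> A"
      "set_decode (gen x (Suc j)) = insert (new (gen x j)) (set_decode (gen x j))"
      using aux[of "gen x j"] 1[of j] step[of j] by auto
  qed
  have ex_unused: "\<exists>j. new (gen x j) \<notin> set_decode u" for x u
  proof -
    have "new (gen x i) \<in> set_decode (gen x j)" if "i < j" for i j
      using that
    proof (induction j)
      case (Suc j)
      then show ?case using gen_Suc[of x j] by (auto simp: less_Suc_eq)
    qed simp
    then have "inj (\<lambda>j. new (gen x j))" using gen_new(1) by (intro linorder_injI) metis
    then have "infinite (range (\<lambda>j. new (gen x j)))" by (rule range_inj_infinite)
    then have "\<not> range (\<lambda>j. new (gen x j)) \<subseteq> set_decode u"
      using finite_subset finite_set_decode by blast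
    then show ?thesis by auto
  qed
  define index where "index z = (LEAST j. new (gen (pfst (pfst z)) j) \<notin> set_decode (psnd z))" for z
  have "total_recursive index" unfolding index_def
    by (intro recursive_intros rec_new rec_gen) (rule ex_unused)
  define pick where "pick m u = new (gen (pfst m) (index (prod_encode (m, u))))" for m u
  have rec_pick: "total_recursive (\<lambda>z. pick (h z) (k z))" if "total_recursive h" "total_recursive k" for h k
    unfolding pick_def
    by (intro rec_new rec_gen recursive_comp[OF \<open>total_recursive index\<close>] recursive_intros that)
  have pick: "pick m u \<notin> set_decode u" "pick m u \<in> A \<longleftrightarrow> pfst m \<in> A" for m u
    using LeastI_ex[OF ex_unused[of "pfst m" u]] gen_new(2) by (auto simp: pick_def index_def)
  define used where "used m = rec_nat 0 (\<lambda>m u. u + 2 ^ pick m u) m" for m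
  define F where "F m = pick m (used m)" for m
  have used: "set_decode (used m) = F ` {..<m}" for m
  proof (induction m)
    case (Suc m)
    have "used (Suc m) = used m + 2 ^ F m" by (simp add: used_def F_def)
    then show ?case using Suc pick(1)[of m "used m"] by (simp add: set_decode_insert lessThan_Suc F_def)
  qed (simp add: used_def)
  have "F i \<noteq> F j" if "i < j" for i j
  proof -
    have "F j \<notin> F ` {..<j}" using pick(1)[of j "used j"] used[of j] by (simp add: F_def[of j])
    with that show ?thesis by (metis imageI lessThan_iff)
  qed
  then have "inj F" by (rule linorder_injI)
  moreover have "total_recursive F" unfolding F_def used_def by (intro recursive_intros rec_pick)
  ultimately have "one_one_reducible (prod_encode ` (A \<times> UNIV)) A"
    using pick(2) unfolding one_one_reducible_def many_one_reduction_def cylinder_code F_def by blast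
  moreover have "one_one_reducible A (prod_encode ` (A \<times> UNIV))"
    unfolding one_one_reducible_def many_one_reduction_def cylinder_code
    by (rule exI[of _ "\<lambda>x. prod_encode (x, 0)"]) (auto intro!: recursive_intros injI)
  ultimately show ?thesis by (simp add: cylinder_def equivalent_def)
qed

section \<open>Pullbacks along recursive sets of labels\<close>

lemma recursive_enumerate:
  fixes D :: "nat set"
  assumes dec: "decidable (\<lambda>n. n \<in> D)" and inf: "infinite D"
  shows "total_recursive (enumerate D)"
    and "\<exists>i. total_recursive i \<and> (\<forall>k. i (enumerate D k) = k)"
proof -
  have ex: "\<exists>m. m \<in> D \<and> b < m" for b using inf by (metis infinite_nat_iff_unbounded)
  have "enumerate D k = rec_nat (LEAST m. m \<in> D) (\<lambda>k b. LEAST m. m \<in> D \<and> b < m) k" for k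
    by (induction k) (simp_all add: enumerate_0 enumerate_Suc''[OF inf] del: enumerate_Suc)
  then have "enumerate D = (\<lambda>k. rec_nat (LEAST m. m \<in> D) (\<lambda>k b. LEAST m. m \<in> D \<and> b < m) k)"
    by (rule ext)
  moreover have "total_recursive (\<lambda>z. LEAST m. m \<in> D \<and> psnd z < m)"
    by (intro recursive_intros recursive_comp[OF dec] ex)
  then have "total_recursive (\<lambda>k. rec_nat (LEAST m. m \<in> D) (\<lambda>k b. LEAST m. m \<in> D \<and> b < m) k)"
    by (intro recursive_rec_nat recursive_id recursive_const)
  ultimately show e: "total_recursive (enumerate D)" by (simp only:)
  have mono: "strict_mono (enumerate D)" using inf by (rule strict_mono_enumerate)
  show "\<exists>i. total_recursive i \<and> (\<forall>k. i (enumerate D k) = k)"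
  proof (intro exI conjI allI)
    have "\<exists>k. n \<le> enumerate D k" for n using strict_mono_imp_increasing[OF mono] by blast
    then show "total_recursive (\<lambda>n. LEAST k. n \<le> enumerate D k)"
      by (intro recursive_intros recursive_comp[OF e])
    show "(LEAST l. enumerate D k \<le> enumerate D l) = k" for k
      using mono by (intro Least_equality) (simp_all add: strict_mono_less_eq)
  qed
qed

text \<open>
  The tokens labelled in \<open>S\<close> form an infinite recursive set, and its increasing enumeration turns the part
  of it that lies over \<open>A\<close> into a set of numbers. The label \<open>0\<close> of the base tokens will belong to all \<open>S\<close> in
  use.
\<close>

definition tokens_labelled :: "nat set \<Rightarrow> nat set" where
  "tokens_labelled S = {n. label_of (token n) \<in> S}"

definition pullback :: "nat set \<Rightarrow> nat set \<Rightarrow> nat set" where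
  "pullback A S = {k. place_of (token (enumerate (tokens_labelled S) k)) \<in> A}"

lemma tokens_labelled_props:
  assumes "decidable (\<lambda>d. d \<in> S)" "0 \<in> S"
  shows "infinite (tokens_labelled S)" "decidable (\<lambda>n. n \<in> tokens_labelled S)"
    "prod_encode (0, x) \<in> tokens_labelled S"
proof -
  show base: "prod_encode (0, x) \<in> tokens_labelled S" for x
    using assms(2) by (simp add: tokens_labelled_def base_token)
  have "infinite (range (\<lambda>x. prod_encode (0, x)))" by (intro range_inj_infinite injI) simp
  then show "infinite (tokens_labelled S)" using base by (meson finite_subset image_subsetI)
  show "decidable (\<lambda>n. n \<in> tokens_labelled S)"
    using recursive_comp[OF assms(1) recursive_pfst[OF recursive_token]]
    by (simp add: tokens_labelled_def)
qed

lemma pullback_mono: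
  assumes S: "decidable (\<lambda>d. d \<in> S)" "0 \<in> S" and T: "decidable (\<lambda>d. d \<in> T)" "0 \<in> T"
    and "S \<subseteq> T"
  shows "one_one_reducible (pullback A S) (pullback A T)"
proof -
  let ?S = "tokens_labelled S" and ?T = "tokens_labelled T"
  note S' = tokens_labelled_props[OF S] and T' = tokens_labelled_props[OF T]
  obtain i where i: "total_recursive i" "\<And>k. i (enumerate ?T k) = k"
    using recursive_enumerate(2)[OF T'(2,1)] by blast
  have *: "enumerate ?T (i (enumerate ?S k)) = enumerate ?S k" for k
  proof -
    have "?S \<subseteq> ?T" using \<open>S \<subseteq> T\<close> by (auto simp: tokens_labelled_def)
    then have "enumerate ?S k \<in> ?T" using enumerate_in_set[OF S'(1)] by (rule subsetD)
    then obtain l where "enumerate ?T l = enumerate ?S k" using enumerate_Ex[OF T'(1)] by blast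
    with i(2)[of l] show ?thesis by simp
  qed
  show ?thesis unfolding one_one_reducible_def many_one_reduction_def
  proof (intro exI conjI allI)
    show "total_recursive (\<lambda>k. i (enumerate ?S k))"
      by (rule recursive_comp[OF i(1) recursive_enumerate(1)[OF S'(2,1)]])
    show "k \<in> pullback A S \<longleftrightarrow> i (enumerate ?S k) \<in> pullback A T" for k
      by (simp add: pullback_def *)
    show "inj (\<lambda>k. i (enumerate ?S k))"
    proof (rule injI)
      fix k l assume "i (enumerate ?S k) = i (enumerate ?S l)"
      then have "enumerate ?S k = enumerate ?S l" by (metis *)
      then show "k = l" by (rule injD[OF inj_enumerate[OF S'(1)]])
    qed
  qed
qed

lemma one_one_reducible_pullback:
  assumes S: "decidable (\<lambda>d. d \<in> S)" "0 \<in> S"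
  shows "one_one_reducible A (pullback A S)"
proof -
  let ?S = "tokens_labelled S"
  note S' = tokens_labelled_props[OF S]
  obtain i where i: "total_recursive i" "\<And>k. i (enumerate ?S k) = k"
    using recursive_enumerate(2)[OF S'(2,1)] by blast
  have *: "enumerate ?S (i (prod_encode (0, x))) = prod_encode (0, x)" for x
  proof -
    obtain l where "enumerate ?S l = prod_encode (0, x)" using enumerate_Ex[OF S'(1) S'(3)] by blast
    with i(2)[of l] show ?thesis by simp
  qed
  show ?thesis unfolding one_one_reducible_def many_one_reduction_def
  proof (intro exI conjI allI)
    show "total_recursive (\<lambda>x. i (prod_encode (0, x)))"
      by (intro recursive_comp[OF i(1)] recursive_intros)
    show "x \<in> A \<longleftrightarrow> i (prod_encode (0, x)) \<in> pullback A S" for x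
      by (simp add: pullback_def * base_token)
    show "inj (\<lambda>x. i (prod_encode (0, x)))"
    proof (rule injI)
      fix x y assume "i (prod_encode (0, x)) = i (prod_encode (0, y))"
      then have "prod_encode (0, x) = prod_encode (0, y)" by (metis *)
      then show "x = y" by simp
    qed
  qed
qed

lemma pullback_finite_one_reducible:
  assumes S: "decidable (\<lambda>d. d \<in> S)" "0 \<in> S"
  shows "finite_one_reducible (pullback A S) A"
proof -
  let ?S = "tokens_labelled S"
  note S' = tokens_labelled_props[OF S]
  show ?thesis unfolding finite_one_reducible_def many_one_reduction_def
  proof (intro exI conjI allI)
    show "total_recursive (\<lambda>k. place_of (token (enumerate ?S k)))"
      by (intro recursive_psnd recursive_comp[OF recursive_token] recursive_enumerate(1) S')
    show "k \<in> pullback A S \<longleftrightarrow> place_of (token (enumerate ?S k)) \<in> A" for k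
      by (simp add: pullback_def)
    have "finite (enumerate ?S -` {n. place_of (token n) = y})" for y
      by (rule finite_vimageI[OF finite_place inj_enumerate[OF S'(1)]])
    then show "finite {k. place_of (token (enumerate ?S k)) = y}" for y by (simp add: vimage_def)
  qed
qed

text \<open>
  The program of the requirement is chosen for \<open>S\<close>, \<open>T\<close> and the given reduction, transferred from numbers
  to tokens. It may refer to \<open>token\<close>, since that function is recursive.
\<close>

lemma pullback_reflects_subset:
  assumes A: "\<not> recursive_set A" "\<not> cylinder A"
    and S: "decidable (\<lambda>d. d \<in> S)" "0 \<in> S" and T: "decidable (\<lambda>d. d \<in> T)" "0 \<in> T"
    and red: "one_one_reducible (pullback A S) (pullback A T)"
  shows "S \<subseteq> T"
proof
  fix r assume "r \<in> S"
  show "r \<in> T"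
  proof (rule ccontr)
    assume "r \<notin> T"
    let ?S = "tokens_labelled S" and ?T = "tokens_labelled T"
    note S' = tokens_labelled_props[OF S] and T' = tokens_labelled_props[OF T]
    obtain i where i: "total_recursive i" "\<And>k. i (enumerate ?S k) = k"
      using recursive_enumerate(2)[OF S'(2,1)] by blast
    obtain f where f: "total_recursive f" "\<And>k. k \<in> pullback A S \<longleftrightarrow> f k \<in> pullback A T" "inj f"
      using red unfolding one_one_reducible_def many_one_reduction_def by blast
    define g where "g n = enumerate ?T (f (i n))" for n
    have rec_g: "total_recursive g" unfolding g_def
      by (intro recursive_comp[OF recursive_enumerate(1)[OF T'(2,1)]] recursive_comp[OF f(1)] i)
    have in_A: "place_of (token (g n)) \<in> A \<longleftrightarrow> place_of (token n) \<in> A" if n: "n \<in> ?S" for n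
    proof -
      obtain k where "enumerate ?S k = n" using enumerate_Ex[OF S'(1) n] by blast
      then show ?thesis using f(2)[of k] i(2)[of k] by (auto simp: pullback_def g_def)
    qed
    have "g ` ?S \<subseteq> ?T" using enumerate_in_set[OF T'(1)] by (auto simp: g_def)
    moreover have "inj_on g ?S"
    proof (rule inj_onI)
      fix m n assume mn: "m \<in> ?S" "n \<in> ?S" "g m = g n"
      then have "f (i m) = f (i n)" using injD[OF inj_enumerate[OF T'(1)]] by (simp add: g_def)
      then have "i m = i n" by (rule injD[OF f(3)])
      moreover obtain k l where "enumerate ?S k = m" "enumerate ?S l = n"
        using enumerate_Ex[OF S'(1)] mn(1,2) by blast
      ultimately show "m = n" using i(2)[of k] i(2)[of l] by auto
    qed
    moreover have "total_recursive (\<lambda>n. prod_encode (of_bool (n \<in> ?S), prod_encode (of_bool (n \<in> ?T), g n)))"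
      by (intro recursive_pair S' T' rec_g)
    then obtain p where "\<And>n. \<exists>s. run_steps p n s =
        Suc (prod_encode (of_bool (n \<in> ?S), prod_encode (of_bool (n \<in> ?T), g n)))"
      using run_steps_complete by blast
    moreover have "n \<in> ?S \<and> n \<notin> ?T" if "label_of (token n) = r" for n
      using that \<open>r \<in> S\<close> \<open>r \<notin> T\<close> by (simp add: tokens_labelled_def)
    ultimately obtain N where N: "\<And>D. finite D \<Longrightarrow> \<exists>x\<in>D. N \<le> x \<Longrightarrow>
        \<exists>n\<in>?S. place_of (token n) \<in> D \<and> place_of (token (g n)) \<notin> D"
      using requirement_met[of p ?S ?T g r] by blast
    define leaves where "leaves d n \<longleftrightarrow>
        n \<in> ?S \<and> place_of (token n) \<in> set_decode d \<and> place_of (token (g n)) \<notin> set_decode d" for d n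
    \<comment> \<open>Codes below \<open>2 ^ N\<close> are those of the sets below \<open>N\<close>, where the search need not succeed.\<close>
    define new where "new d = place_of (token (g (LEAST n. d < 2 ^ N \<or> leaves d n)))" for d
    have ex: "\<exists>n. d < 2 ^ N \<or> leaves d n" for d
    proof (cases "\<exists>x\<in>set_decode d. N \<le> x")
      case True
      with N[of "set_decode d"] show ?thesis by (auto simp: leaves_def)
    next
      case False
      then have "set_encode (set_decode d) < 2 ^ N" by (intro set_encode_less) (auto simp: not_le)
      then show ?thesis by (simp add: set_decode_inverse)
    qed
    have "total_recursive (\<lambda>d. LEAST n. d < 2 ^ N \<or> leaves d n)"
    proof (rule recursive_least[OF _ ex])
      show "decidable (\<lambda>z. pfst z < 2 ^ N \<or> leaves (pfst z) (psnd z))"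
        unfolding leaves_def
        by (intro recursive_intros recursive_comp[OF S'(2)] recursive_comp[OF recursive_token]
            recursive_comp[OF rec_g])
    qed
    then have "total_recursive new" unfolding new_def
      by (intro recursive_psnd recursive_comp[OF recursive_token] recursive_comp[OF rec_g])
    then have "cylinder A"
    proof (rule cylinder_if_fresh[OF A(1), where N = N])
      fix D assume D: "finite D" "\<exists>x\<in>D. N \<le> x" "D \<subseteq> A \<or> D \<inter> A = {}"
      define d where "d = set_encode D"
      have d: "set_decode d = D" using D(1) by (simp add: d_def set_encode_inverse)
      have "\<not> d < 2 ^ N" using D(2) set_decode_less[of _ d N] d by force
      then have "leaves d (LEAST n. d < 2 ^ N \<or> leaves d n)" using LeastI_ex[OF ex[of d]] by blast
      then show "new (set_encode D) \<notin> D \<and> (new (set_encode D) \<in> A \<longleftrightarrow> D \<subseteq> A)"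
        using D(3) in_A d unfolding leaves_def new_def d_def[symmetric] by blast
    qed
    with A(2) show False ..
  qed
qed

section \<open>Countable partial orders as inclusions of recursive sets\<close>

text \<open>
  Think of a number \<open>d\<close> as the finite set of indices that it codes. The set for \<open>j\<close> is
  \<open>{d. j \<in> set_decode d}\<close>, corrected, in the order of the indices, by what the elements \<open>i < j\<close>
  below or above \<open>j\<close> force. The order need not be decidable: each single set consults only finitely much
  of it.
\<close>

fun order_set :: "(nat \<Rightarrow> nat \<Rightarrow> bool) \<Rightarrow> nat \<Rightarrow> nat set" where
  "order_set le j = {d. (j \<in> set_decode d \<or> (\<exists>i\<in>{i \<in> {..<j}. le i j}. d \<in> order_set le i)) \<and>
     (\<forall>i\<in>{i \<in> {..<j}. le j i}. d \<in> order_set le i)}"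

declare order_set.simps [simp del]

lemma decidable_finite_ex:
  "finite F \<Longrightarrow> (\<And>i. i \<in> F \<Longrightarrow> decidable (Q i)) \<Longrightarrow> decidable (\<lambda>d. \<exists>i\<in>F. Q i d)"
proof (induction F rule: finite_induct)
  case (insert a F)
  then show ?case unfolding bex_simps by (intro decidable_disj) auto
qed (simp add: recursive_intros)

lemma decidable_finite_all:
  assumes "finite F" "\<And>i. i \<in> F \<Longrightarrow> decidable (Q i)"
  shows "decidable (\<lambda>d. \<forall>i\<in>F. Q i d)"
proof -
  have "decidable (\<lambda>d. \<not> (\<exists>i\<in>F. \<not> Q i d))"
    using assms by (intro decidable_not decidable_finite_ex)
  then show ?thesis by (simp only: ball_simps bex_simps not_not)
qed

lemma decidable_order_set: "decidable (\<lambda>d. d \<in> order_set le j)"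
proof (induction j rule: less_induct)
  case (less j)
  show ?case
    unfolding order_set.simps[of le j] mem_Collect_eq
    by (intro decidable_conj decidable_disj decidable_finite_ex decidable_finite_all
        decidable_set_decode recursive_const recursive_id) (use less in auto)
qed

lemma order_set_mono:
  assumes trans: "\<And>i j k. le i j \<Longrightarrow> le j k \<Longrightarrow> le i k" and "le i j"
  shows "order_set le i \<subseteq> order_set le j"
proof -
  have "\<forall>i<n. \<forall>j<n. le i j \<longrightarrow> order_set le i \<subseteq> order_set le j" for n
  proof (induction n)
    case (Suc n)
    have "order_set le i \<subseteq> order_set le n" if i: "i < n" "le i n" for i
    proof
      fix d assume d: "d \<in> order_set le i"
      have "d \<in> order_set le k" if "k < n" "le n k" for k
        using Suc.IH i that d trans by blast
      with d i show "d \<in> order_set le n" by (subst order_set.simps) auto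
    qed
    moreover have "order_set le n \<subseteq> order_set le i" if "i < n" "le n i" for i
      using that by (subst order_set.simps) auto
    ultimately show ?case using Suc.IH by (auto simp: less_Suc_eq)
  qed simp
  from this[of "Suc (max i j)"] \<open>le i j\<close> show ?thesis by (simp add: less_Suc_eq_le)
qed

lemma order_set_reflects:
  assumes trans: "\<And>i j k. le i j \<Longrightarrow> le j k \<Longrightarrow> le i k" and "le i i"
    and sub: "order_set le i \<subseteq> order_set le j"
  shows "le i j"
proof -
  \<comment> \<open>A finite piece of the up-set of \<open>i\<close> is consistent, so the corrections do not affect it.\<close>
  define D where "D = {k. k \<le> max i j \<and> le i k}"
  have "finite D" by (rule finite_subset[of _ "{..max i j}"]) (auto simp: D_def)
  then have D: "set_decode (set_encode D) = D" by (rule set_encode_inverse)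
  have "k \<le> max i j \<Longrightarrow> set_encode D \<in> order_set le k \<longleftrightarrow> le i k" for k
  proof (induction k rule: less_induct)
    case (less k)
    have IH: "set_encode D \<in> order_set le l \<longleftrightarrow> le i l" if "l < k" for l
      using less.IH[OF that] less.prems that by simp
    have "k \<in> D \<longleftrightarrow> le i k" using less.prems by (simp add: D_def)
    then show ?case
      using IH trans by (subst order_set.simps) (auto simp: D)
  qed
  with sub \<open>le i i\<close> show ?thesis by (metis max.cobounded1 max.cobounded2 subsetD)
qed

lemma countable_order_as_recursive_sets:
  fixes P :: "'a set"
  assumes "countable P" and po: "partial_order_on P r"
  obtains S :: "'a \<Rightarrow> nat set" where "\<And>p. decidable (\<lambda>d. d \<in> S p)" "\<And>p. 0 \<in> S p"
    "\<And>p q. p \<in> P \<Longrightarrow> q \<in> P \<Longrightarrow> S p \<subseteq> S q \<longleftrightarrow> (p, q) \<in> r"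
proof -
  obtain f :: "'a \<Rightarrow> nat" where f: "inj_on f P" using assms(1) by (rule countableE)
  define le where "le i j \<longleftrightarrow> (\<exists>p\<in>P. \<exists>q\<in>P. i = f p \<and> j = f q \<and> (p, q) \<in> r)" for i j
  have le: "le (f p) (f q) \<longleftrightarrow> (p, q) \<in> r" if "p \<in> P" "q \<in> P" for p q
    using that f by (auto simp: le_def inj_on_def)
  have "trans r" and refl: "\<And>p. p \<in> P \<Longrightarrow> (p, p) \<in> r"
    using po by (auto simp: partial_order_on_def preorder_on_def refl_on_def)
  have trans: "le i k" if "le i j" "le j k" for i j k
    using that f \<open>trans r\<close> unfolding le_def by (metis inj_onD transD)
  \<comment> \<open>The shift makes room for a common element \<open>0\<close>.\<close>
  define S where "S p = insert 0 (Suc ` order_set le (f p))" for p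
  show thesis
  proof (rule that)
    fix p
    show "0 \<in> S p" by (simp add: S_def)
    have "d \<in> S p \<longleftrightarrow> d = 0 \<or> d - 1 \<in> order_set le (f p)" for d
      by (cases d) (auto simp: S_def intro: rev_image_eqI)
    moreover have "decidable (\<lambda>d. d = 0 \<or> d - 1 \<in> order_set le (f p))"
      by (intro recursive_intros recursive_comp[OF decidable_order_set])
    ultimately show "decidable (\<lambda>d. d \<in> S p)" by (simp only:)
  next
    fix p q assume pq: "p \<in> P" "q \<in> P"
    have "S p \<subseteq> S q \<longleftrightarrow> order_set le (f p) \<subseteq> order_set le (f q)" by (auto simp: S_def)
    also have "\<dots> \<longleftrightarrow> le (f p) (f q)"
    proof
      assume sub: "order_set le (f p) \<subseteq> order_set le (f q)"
      have "le (f p) (f p)" using le[OF pq(1,1)] refl[OF pq(1)] by simp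
      then show "le (f p) (f q)" using sub by (rule order_set_reflects[rotated 1]) (rule trans)
    next
      assume "le (f p) (f q)"
      then show "order_set le (f p) \<subseteq> order_set le (f q)"
        by (rule order_set_mono[rotated 1]) (rule trans)
    qed
    finally show "S p \<subseteq> S q \<longleftrightarrow> (p, q) \<in> r" using le[OF pq] by simp
  qed
qed

section \<open>Degrees\<close>

lemma many_one_reduction_comp:
  "many_one_reduction A B f \<Longrightarrow> many_one_reduction B C g \<Longrightarrow> many_one_reduction A C (\<lambda>x. g (f x))"
  unfolding many_one_reduction_def by (auto intro: recursive_comp)

lemma one_one_reducible_refl: "one_one_reducible A A"
  unfolding one_one_reducible_def many_one_reduction_def
  by (rule exI[of _ "\<lambda>x. x"]) (auto intro: recursive_id)

lemma one_one_reducible_trans: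
  "one_one_reducible A B \<Longrightarrow> one_one_reducible B C \<Longrightarrow> one_one_reducible A C"
  unfolding one_one_reducible_def by (meson many_one_reduction_comp inj_compose[unfolded comp_def])

lemma many_one_reducible_trans:
  "many_one_reducible A B \<Longrightarrow> many_one_reducible B C \<Longrightarrow> many_one_reducible A C"
  unfolding many_one_reducible_def by (meson many_one_reduction_comp)

lemma finite_one_reducible_trans:
  assumes "finite_one_reducible A B" "finite_one_reducible B C"
  shows "finite_one_reducible A C"
proof -
  obtain f g where f: "many_one_reduction A B f" "\<And>y. finite {x. f x = y}"
    and g: "many_one_reduction B C g" "\<And>y. finite {x. g x = y}"
    using assms unfolding finite_one_reducible_def by blast
  have "finite {x. g (f x) = z}" for z
  proof -
    have "{x. g (f x) = z} = (\<Union>y\<in>{y. g y = z}. {x. f x = y})" by auto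
    with f(2) g(2) show ?thesis by simp
  qed
  with many_one_reduction_comp[OF f(1) g(1)] show ?thesis unfolding finite_one_reducible_def by blast
qed

lemma one_one_imp_finite_one: "one_one_reducible A B \<Longrightarrow> finite_one_reducible A B"
proof -
  have "finite {x. f x = y}" if "inj f" for f :: "nat \<Rightarrow> nat" and y
    using finite_vimageI[OF _ that, of "{y}"] by (simp add: vimage_def)
  then show "one_one_reducible A B \<Longrightarrow> finite_one_reducible A B"
    unfolding one_one_reducible_def finite_one_reducible_def by blast
qed

lemma finite_one_imp_many_one: "finite_one_reducible A B \<Longrightarrow> many_one_reducible A B"
  unfolding finite_one_reducible_def many_one_reducible_def by blast

text \<open>The second component of \<open>B \<times> \<nat>\<close> can store the argument, which makes any reduction injective.\<close>

lemma many_one_to_cylinder: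
  assumes "many_one_reducible A B" "cylinder B"
  shows "one_one_reducible A B"
proof -
  obtain f where f: "total_recursive f" "\<And>x. x \<in> A \<longleftrightarrow> f x \<in> B"
    using assms(1) unfolding many_one_reducible_def many_one_reduction_def by blast
  have "one_one_reducible A (prod_encode ` (B \<times> UNIV))"
    unfolding one_one_reducible_def many_one_reduction_def cylinder_code
    by (rule exI[of _ "\<lambda>x. prod_encode (f x, x)"]) (auto intro!: recursive_intros f injI)
  with assms(2) show ?thesis
    unfolding cylinder_def equivalent_def by (blast intro: one_one_reducible_trans)
qed

lemma one_one_degree_le_iff:
  "one_one_degree_le (degree_of one_one_reducible A) (degree_of one_one_reducible B) \<longleftrightarrow> one_one_reducible A B"
  unfolding one_one_degree_le_def degree_of_def equivalent_def
  by (auto intro: one_one_reducible_trans one_one_reducible_refl)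

lemma order_embeds_in_degree:
  fixes P :: "'a set"
  assumes A: "\<not> recursive_set A" "\<not> cylinder A"
    and red: "\<And>X Y. finite_one_reducible X Y \<Longrightarrow> red X Y"
    and red_trans: "\<And>X Y Z. red X Y \<Longrightarrow> red Y Z \<Longrightarrow> red X Z"
    and P: "countable P" "partial_order_on P r"
  shows "embeds_in P r (one_one_degrees_in (degree_of red A)) one_one_degree_le"
proof -
  obtain S :: "'a \<Rightarrow> nat set" where S: "\<And>p. decidable (\<lambda>d. d \<in> S p)" "\<And>p. 0 \<in> S p"
      and sub: "\<And>p q. p \<in> P \<Longrightarrow> q \<in> P \<Longrightarrow> S p \<subseteq> S q \<longleftrightarrow> (p, q) \<in> r"
    using countable_order_as_recursive_sets[OF P] by metis
  have one: "red X Y" if "one_one_reducible X Y" for X Y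
    using that by (intro red one_one_imp_finite_one)
  define \<iota> where "\<iota> p = degree_of one_one_reducible (pullback A (S p))" for p
  have le: "one_one_degree_le (\<iota> p) (\<iota> q) \<longleftrightarrow> (p, q) \<in> r" if "p \<in> P" "q \<in> P" for p q
    unfolding \<iota>_def one_one_degree_le_iff sub[OF that, symmetric]
    using pullback_mono[OF S S] pullback_reflects_subset[OF A S S] by blast
  have "equivalent red A (pullback A (S p))" for p
    unfolding equivalent_def
    using one_one_reducible_pullback[OF S] pullback_finite_one_reducible[OF S] one red by blast
  then have "\<iota> p \<subseteq> degree_of red A" for p
    unfolding \<iota>_def degree_of_def equivalent_def using one red_trans by blast
  then have "\<iota> ` P \<subseteq> one_one_degrees_in (degree_of red A)"
    by (auto simp: one_one_degrees_in_def is_degree_def \<iota>_def)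
  moreover have "inj_on \<iota> P"
  proof (rule inj_onI)
    fix p q assume pq: "p \<in> P" "q \<in> P" "\<iota> p = \<iota> q"
    have "(p, p) \<in> r"
      using P(2) pq(1) by (auto simp: partial_order_on_def preorder_on_def refl_on_def)
    then have "(p, q) \<in> r" "(q, p) \<in> r"
      using le[OF pq(1,2)] le[OF pq(2,1)] le[OF pq(1,1)] pq(3) by simp_all
    with P(2) show "p = q" by (simp add: partial_order_on_def antisym_def)
  qed
  ultimately show ?thesis using le unfolding embeds_in_def by blast
qed

text \<open>
  By \<open>many_one_to_cylinder\<close>, a degree that consists of cylinders is contained in the one-one degree of each
  of its members.
\<close>

lemma nonirreducible_has_noncylinder:
  assumes red: "\<And>X Y. one_one_reducible X Y \<Longrightarrow> red X Y"
    and red_many: "\<And>X Y. red X Y \<Longrightarrow> many_one_reducible X Y"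
    and D: "is_degree red D" "\<not> irreducible_degree D"
  shows "\<exists>A\<in>D. \<not> cylinder A"
proof (rule ccontr)
  assume "\<not> ?thesis"
  then have cyl: "cylinder B" if "B \<in> D" for B using that by blast
  obtain A where A: "D = degree_of red A" using D(1) unfolding is_degree_def by blast
  have "A \<in> D" using red one_one_reducible_refl by (simp add: A degree_of_def equivalent_def)
  have "B \<in> D \<longleftrightarrow> B \<in> degree_of one_one_reducible A" for B
  proof
    assume "B \<in> D"
    then show "B \<in> degree_of one_one_reducible A"
      using cyl[OF \<open>A \<in> D\<close>] cyl[OF \<open>B \<in> D\<close>] red_many
      by (auto simp: A degree_of_def equivalent_def intro: many_one_to_cylinder)
  qed (use red in \<open>auto simp: A degree_of_def equivalent_def\<close>)
  then have "D = degree_of one_one_reducible A" by blast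
  with D(2) show False by (auto simp: irreducible_degree_def is_degree_def)
qed

lemma degree_of_member:
  assumes "\<And>X Y Z. red X Y \<Longrightarrow> red Y Z \<Longrightarrow> red X Z" "is_degree red D" "A \<in> D"
  shows "D = degree_of red A"
  using assms unfolding is_degree_def degree_of_def equivalent_def by blast

lemma nonirreducible_degree:
  assumes fin: "\<And>X Y. finite_one_reducible X Y \<Longrightarrow> red X Y"
    and many: "\<And>X Y. red X Y \<Longrightarrow> many_one_reducible X Y"
    and trans: "\<And>X Y Z. red X Y \<Longrightarrow> red Y Z \<Longrightarrow> red X Z"
    and D: "is_degree red D" "nonrecursive_degree D" "\<not> irreducible_degree D"
  shows "(\<exists>A\<in>D. \<not> recursive_set A \<and> \<not> cylinder A) \<and>
    (\<forall>(P :: 'a set) r. countable P \<and> partial_order_on P r \<longrightarrow>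
       embeds_in P r (one_one_degrees_in D) one_one_degree_le)"
proof -
  obtain A where A: "A \<in> D" "\<not> cylinder A"
    using nonirreducible_has_noncylinder[OF fin[OF one_one_imp_finite_one] many D(1,3)] by blast
  have nonrec: "\<not> recursive_set A" using A(1) D(2) by (simp add: nonrecursive_degree_def)
  have "D = degree_of red A" by (rule degree_of_member[OF trans D(1) A(1)])
  moreover have "embeds_in P r (one_one_degrees_in (degree_of red A)) one_one_degree_le"
    if "countable P" "partial_order_on P r" for P :: "'a set" and r
    by (rule order_embeds_in_degree[where red = red, OF nonrec A(2) _ _ that]) (fact fin, fact trans)
  ultimately show ?thesis using A nonrec by blast
qed

lemma isomorphic_refl: "isomorphic A A"
  unfolding isomorphic_def by (rule exI[of _ "\<lambda>x. x"]) (auto simp: recursive_id bij_def)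

theorem corollary14:
  shows
    "(\<forall>A. \<not> recursive_set A \<and> \<not> (\<exists>C. cylinder C \<and> isomorphic A C) \<longrightarrow>
        (\<forall>(P :: 'a set) r. countable P \<and> partial_order_on P r \<longrightarrow>
           embeds_in P r (one_one_degrees_in (degree_of finite_one_reducible A)) one_one_degree_le \<and>
           embeds_in P r (one_one_degrees_in (degree_of many_one_reducible A)) one_one_degree_le)) \<and>
     (\<forall>D. is_degree many_one_reducible D \<and> nonrecursive_degree D \<and> \<not> irreducible_degree D \<longrightarrow>
        (\<exists>A\<in>D. \<not> recursive_set A \<and> \<not> cylinder A) \<and>
        (\<forall>(P :: 'a set) r. countable P \<and> partial_order_on P r \<longrightarrow>
           embeds_in P r (one_one_degrees_in D) one_one_degree_le)) \<and>
     (\<forall>D. is_degree finite_one_reducible D \<and> nonrecursive_degree D \<and> \<not> irreducible_degree D \<longrightarrow>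
        (\<exists>A\<in>D. \<not> recursive_set A \<and> \<not> cylinder A) \<and>
        (\<forall>(P :: 'a set) r. countable P \<and> partial_order_on P r \<longrightarrow>
           embeds_in P r (one_one_degrees_in D) one_one_degree_le))"
proof (intro conjI allI impI)
  fix A :: "nat set" and P :: "'a set" and r
  assume "\<not> recursive_set A \<and> \<not> (\<exists>C. cylinder C \<and> isomorphic A C)"
    and P: "countable P \<and> partial_order_on P r"
  then have A: "\<not> recursive_set A" "\<not> cylinder A" using isomorphic_refl by blast+
  show "embeds_in P r (one_one_degrees_in (degree_of finite_one_reducible A)) one_one_degree_le"
    by (rule order_embeds_in_degree[where red = finite_one_reducible, OF A])
      (use P finite_one_reducible_trans in blast)+
  show "embeds_in P r (one_one_degrees_in (degree_of many_one_reducible A)) one_one_degree_le"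
    by (rule order_embeds_in_degree[where red = many_one_reducible, OF A])
      (use P finite_one_imp_many_one many_one_reducible_trans in blast)+
next
  fix D
  assume "is_degree many_one_reducible D \<and> nonrecursive_degree D \<and> \<not> irreducible_degree D"
  then show "\<exists>A\<in>D. \<not> recursive_set A \<and> \<not> cylinder A"
    and "\<And>(P :: 'a set) r. countable P \<and> partial_order_on P r \<Longrightarrow>
      embeds_in P r (one_one_degrees_in D) one_one_degree_le"
    using nonirreducible_degree[of many_one_reducible D] finite_one_imp_many_one many_one_reducible_trans
    by blast+
next
  fix D
  assume "is_degree finite_one_reducible D \<and> nonrecursive_degree D \<and> \<not> irreducible_degree D"
  then show "\<exists>A\<in>D. \<not> recursive_set A \<and> \<not> cylinder A"
    and "\<And>(P :: 'a set) r. countable P \<and> partial_order_on P r \<Longrightarrow>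
      embeds_in P r (one_one_degrees_in D) one_one_degree_le"
    using nonirreducible_degree[of finite_one_reducible D] finite_one_imp_many_one finite_one_reducible_trans
    by blast+
qed

end
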